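(* For every integer $n\ge1$, the numbers of spanning trees of the Aztec pillowcase $AP_n$ and of the odd Aztec pillowcase $OP_n$ are given by $$\mathrm{t}(AP_n)=\mathrm{t}(OP_n)=\frac{1}{2n^2}\prod_{j=1}^{2n-1}\left(4-4\cos\frac{j\pi}{2n}\right)^2\prod_{1\leq j,k\leq 2n-1}\left(4-4\cos\frac{j\pi}{2n}\cos\frac{k\pi}{2n}\right).$$
   Context: $\mathrm{t}(G)$ denotes the number of spanning trees of $G$ (parallel edges are regarded as distinct). The Aztec diamond $AD_n$ is the subgraph of the grid $(\mathbb{Z}+1/2)^2$ (nearest-neighbor edges) induced by the vertices $(x,y)$ with $|x|+|y|\le n$. The odd Aztec diamond $OD_n$ is the graph whose vertices are the black unit squares of a $(2n+1)\times(2n+1)$ chessboard with black corners, two being adjacent if they share a corner; equivalently, it is the subgraph of the grid $\mathbb{Z}^2$ induced by the points $(x,y)$ with $|x|+|y|\le n$. The Aztec pillowcase $AP_n$ is the graph obtained from two copies of $AD_n$ by identifying corresponding vertices on (the boundary of) their convex hull, i.e. the vertices with $|x|+|y|=n$; all edges of both copies are kept, which leads to four pairs of parallel edges. The odd Aztec pillowcase $OP_n$ is defined analogously using two copies of $OD_n$, identifying corresponding vertices with $|x|+|y|=n$. *)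

theory Defs
  imports "HOL-Analysis.Analysis"
begin

section \<open>Undirected multigraphs and their spanning trees\<close>

text \<open>
  Edges are objects of their own, so parallel edges are distinct; \<open>ends e\<close> is the set of
  endpoints of \<open>e\<close>, a singleton when \<open>e\<close> is a loop.  The trees of \<open>Graph_Theory\<close> are not used:
  its acyclicity is that of directed cycles.
\<close>

record ('v, 'e) multigraph =
  verts :: "'v set"
  edges :: "'e set"
  ends :: "'e \<Rightarrow> 'v set"

definition walk :: "('v, 'e) multigraph \<Rightarrow> 'v list \<Rightarrow> 'e list \<Rightarrow> bool" where
  "walk G vs es \<longleftrightarrow> length vs = length es + 1 \<and> set vs \<subseteq> verts G \<and> set es \<subseteq> edges G \<and>
     (\<forall>i < length es. ends G (es ! i) = {vs ! i, vs ! (i + 1)})"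

text \<open>
  Loops are cycles of length 1 and pairs of parallel edges are cycles of length 2; distinctness
  of the edges excludes going back and forth along a single edge.
\<close>

definition cycle :: "('v, 'e) multigraph \<Rightarrow> 'v list \<Rightarrow> 'e list \<Rightarrow> bool" where
  "cycle G vs es \<longleftrightarrow> walk G vs es \<and> es \<noteq> [] \<and> hd vs = last vs \<and> distinct es \<and> distinct (tl vs)"

definition connected_graph :: "('v, 'e) multigraph \<Rightarrow> bool" where
  "connected_graph G \<longleftrightarrow> verts G \<noteq> {} \<and>
     (\<forall>u \<in> verts G. \<forall>v \<in> verts G. \<exists>vs es. walk G vs es \<and> hd vs = u \<and> last vs = v)"

definition tree :: "('v, 'e) multigraph \<Rightarrow> bool" where
  "tree G \<longleftrightarrow> connected_graph G \<and> (\<nexists>vs es. cycle G vs es)"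

definition spanning_trees :: "('v, 'e) multigraph \<Rightarrow> 'e set set" where
  "spanning_trees G = {T. T \<subseteq> edges G \<and> tree (G\<lparr>edges := T\<rparr>)}"

definition num_spanning_trees :: "('v, 'e) multigraph \<Rightarrow> nat" where
  "num_spanning_trees G = card (spanning_trees G)"

definition induced_subgraph :: "('v, 'e) multigraph \<Rightarrow> 'v set \<Rightarrow> ('v, 'e) multigraph" where
  "induced_subgraph G S =
     \<lparr>verts = verts G \<inter> S, edges = {e \<in> edges G. ends G e \<subseteq> S}, ends = ends G\<rparr>"

definition two_copies :: "('v, 'e) multigraph \<Rightarrow> ('v \<times> bool, 'e \<times> bool) multigraph" where
  "two_copies G =
     \<lparr>verts = verts G \<times> UNIV, edges = edges G \<times> UNIV,
      ends = (\<lambda>(e, b). (\<lambda>v. (v, b)) ` ends G e)\<rparr>"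

text \<open>Identification of vertices along an equivalence relation; all edges are kept.\<close>

definition identify :: "('v, 'e) multigraph \<Rightarrow> ('v \<times> 'v) set \<Rightarrow> ('v set, 'e) multigraph" where
  "identify G R =
     \<lparr>verts = verts G // R, edges = edges G, ends = (\<lambda>e. (\<lambda>v. R `` {v}) ` ends G e)\<rparr>"

text \<open>Two copies of \<open>G\<close>, glued along the vertices of \<open>G\<close> that lie in \<open>B\<close>.\<close>

definition pillowcase ::
    "('v, 'e) multigraph \<Rightarrow> 'v set \<Rightarrow> (('v \<times> bool) set, 'e \<times> bool) multigraph" where
  "pillowcase G B = identify (two_copies G)
     {((u, b), (v, c)) | u v b c. u \<in> verts G \<and> u = v \<and> (b = c \<or> u \<in> B)}"


section \<open>Aztec diamonds and pillowcases\<close>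

definition grid :: "(real \<times> real) set \<Rightarrow> (real \<times> real, (real \<times> real) set) multigraph" where
  "grid L = \<lparr>verts = L, edges = {{p, q} | p q. p \<in> L \<and> q \<in> L \<and> dist p q = 1}, ends = (\<lambda>e. e)\<rparr>"

definition int_lattice :: "(real \<times> real) set" where
  "int_lattice = {(x, y). x \<in> \<int> \<and> y \<in> \<int>}"

definition half_int_lattice :: "(real \<times> real) set" where
  "half_int_lattice = {(x, y). x - 1/2 \<in> \<int> \<and> y - 1/2 \<in> \<int>}"

definition l1_ball :: "nat \<Rightarrow> (real \<times> real) set" where
  "l1_ball n = {(x, y). \<bar>x\<bar> + \<bar>y\<bar> \<le> real n}"

definition l1_sphere :: "nat \<Rightarrow> (real \<times> real) set" where
  "l1_sphere n = {(x, y). \<bar>x\<bar> + \<bar>y\<bar> = real n}"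

definition aztec_diamond :: "nat \<Rightarrow> (real \<times> real, (real \<times> real) set) multigraph" where
  "aztec_diamond n = induced_subgraph (grid half_int_lattice) (l1_ball n)"

definition odd_aztec_diamond :: "nat \<Rightarrow> (real \<times> real, (real \<times> real) set) multigraph" where
  "odd_aztec_diamond n = induced_subgraph (grid int_lattice) (l1_ball n)"

definition aztec_pillowcase ::
    "nat \<Rightarrow> (((real \<times> real) \<times> bool) set, (real \<times> real) set \<times> bool) multigraph" where
  "aztec_pillowcase n = pillowcase (aztec_diamond n) (l1_sphere n)"

definition odd_aztec_pillowcase ::
    "nat \<Rightarrow> (((real \<times> real) \<times> bool) set, (real \<times> real) set \<times> bool) multigraph" where
  "odd_aztec_pillowcase n = pillowcase (odd_aztec_diamond n) (l1_sphere n)"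

end

theory Submission
  imports Defs "Jordan_Normal_Form.Determinant"
begin

text \<open>
  In the coordinates \<open>u = x + y + n\<close>, \<open>v = x - y + n\<close> both diamonds are parity classes of the square
  \<open>{0..2n} \<times> {0..2n}\<close> with diagonal adjacency: \<open>u + v\<close> is even for \<open>OD\<^sub>n\<close> and odd for \<open>AD\<^sub>n\<close>.  Gluing two
  copies along the boundary yields one parity class of the quotient of the torus \<open>(\<int>/4n)\<^sup>2\<close> by
  \<open>-1\<close>, so the Laplacian of the pillowcase is diagonalised by the products
  \<open>cos (j\<pi>u/2n) cos (k\<pi>v/2n)\<close> and \<open>sin (j\<pi>u/2n) sin (k\<pi>v/2n)\<close>, with eigenvalue
  \<open>4 - 4 cos (j\<pi>/2n) cos (k\<pi>/2n)\<close>, relative to the weight \<open>degree/4\<close>.  On a parity class the modes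
  \<open>(j, k)\<close> and \<open>(2n - j, 2n - k)\<close> coincide up to sign, so only half of them are needed.  For \<open>(n, n)\<close>
  both products live on the even class, where they contribute an extra factor \<open>4 \<cdot> 4\<close>; it
  cancels against the four corners of \<open>OP\<^sub>n\<close>, which have degree 2 instead of 4.  The matrix-tree
  theorem turns the product of the nonzero eigenvalues into the number of spanning trees.
\<close>

section \<open>Spanning trees as minimal connecting edge sets\<close>

text \<open>On the torus the two sheets are exchanged by (u, v) -> (u, -v). Cosine products are
  invariant under this; sine products change sign and vanish on the seam. So both families descend
  to the glued graph. The corners of \<open>OP_n\<close> have a smaller degree than all other
  vertices, so the modes solve only a generalised eigenvalue problem L F = lam w F and are
  orthogonal with respect to w. Therefore the Laplacian, with one row corrected, and the diagonal
  matrix of w are both transformed by the same matrix of modes and then compared: its determinant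
  and the norms of the modes cancel and are never computed. The product of the eigenvalues over half
  of the modes is reached only through its square: the full square of frequencies consists of the
  inner square, four sides and four corners. The root is fixed by nonnegativity and brings a factor
  2; against the total weight 4 n^2 this leaves the constant 1/(2 n^2).\<close>

definition adj :: "('e \<Rightarrow> 'v set) \<Rightarrow> 'e set \<Rightarrow> ('v \<times> 'v) set" where
  "adj en T = {(u, v). \<exists>e \<in> T. en e = {u, v}}"

text \<open>A set of roots rather than a single one: enlarging \<open>R\<close> plays the role of
  contracting an edge, so the recursion behind the matrix-tree theorem stays on one vertex
  set.\<close>

definition connects :: "('e \<Rightarrow> 'v set) \<Rightarrow> 'v set \<Rightarrow> 'v set \<Rightarrow> 'e set \<Rightarrow> bool" where
  "connects en V R T \<longleftrightarrow> (\<forall>v \<in> V. \<exists>r \<in> R. (v, r) \<in> (adj en T)\<^sup>*)"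

lemma adj_mono: "S \<subseteq> T \<Longrightarrow> adj en S \<subseteq> adj en T"
  unfolding adj_def by blast

lemma connects_mono: "S \<subseteq> T \<Longrightarrow> connects en V R S \<Longrightarrow> connects en V R T"
  unfolding connects_def by (meson adj_mono rtrancl_mono subsetD)

lemma adj_sym: "(u, v) \<in> adj en T \<Longrightarrow> (v, u) \<in> adj en T"
  unfolding adj_def by (auto simp: insert_commute)

lemma adj_rtrancl_sym: "(u, v) \<in> (adj en T)\<^sup>* \<Longrightarrow> (v, u) \<in> (adj en T)\<^sup>*"
  by (meson adj_sym sym_rtrancl symD symI)

text \<open>Follow the path from \<open>v\<close> until it first uses \<open>e\<close>: the part
  before that avoids \<open>e\<close> and stops at an end of \<open>e\<close>, or at
  \<open>w\<close> if \<open>e\<close> never occurs.\<close>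

lemma rtrancl_adj_avoid_edge:
  assumes "(v, w) \<in> (adj en T)\<^sup>*" and e: "en e = {r, s}"
  shows "\<exists>x \<in> {w, r, s}. (v, x) \<in> (adj en (T - {e}))\<^sup>*"
  using assms(1)
proof (induction rule: converse_rtrancl_induct)
  case base
  then show ?case by blast
next
  case (step y z)
  from step(1) obtain f where f: "f \<in> T" "en f = {y, z}"
    unfolding adj_def by auto
  show ?case
  proof (cases "f = e")
    case True
    then have "y \<in> {r, s}" using f e by auto
    then show ?thesis by blast
  next
    case False
    then have "(y, z) \<in> adj en (T - {e})" using f unfolding adj_def by auto
    then show ?thesis using step.IH by (meson converse_rtrancl_into_rtrancl)
  qed
qed

text \<open>Contraction of \<open>e\<close> in disguise: \<open>e\<close> ties \<open>s\<close> to
  the root \<open>r\<close>, so it can be traded for making \<open>s\<close> a root itself.\<close>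

lemma connects_insert_edge:
  assumes e: "e \<in> T" "en e = {r, s}" and r: "r \<in> R"
  shows "connects en V (insert s R) (T - {e}) \<longleftrightarrow> connects en V R T"
proof
  assume c: "connects en V (insert s R) (T - {e})"
  have sr: "(s, r) \<in> (adj en T)\<^sup>*" using e unfolding adj_def by auto
  show "connects en V R T" unfolding connects_def
  proof
    fix v assume "v \<in> V"
    then obtain x where x: "x \<in> insert s R" "(v, x) \<in> (adj en T)\<^sup>*"
      using connects_mono[OF _ c, of T] unfolding connects_def by blast
    then show "\<exists>r \<in> R. (v, r) \<in> (adj en T)\<^sup>*"
      using sr r by (metis insertE rtrancl_trans)
  qed
next
  assume c: "connects en V R T"
  show "connects en V (insert s R) (T - {e})" unfolding connects_def
  proof
    fix v assume "v \<in> V"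
    then obtain x where "x \<in> R" "(v, x) \<in> (adj en T)\<^sup>*" using c unfolding connects_def by blast
    then show "\<exists>r \<in> insert s R. (v, r) \<in> (adj en (T - {e}))\<^sup>*"
      using rtrancl_adj_avoid_edge[of v x en T e r s] e(2) r by auto
  qed
qed

lemma connects_crossing:
  assumes c: "connects en V R T" and v: "v \<in> V - R"
    and T: "\<And>e. e \<in> T \<Longrightarrow> en e \<subseteq> V"
  obtains e r s where "e \<in> T" "en e = {r, s}" "r \<in> R" "s \<in> V - R"
proof -
  obtain x where x: "x \<in> R" "(v, x) \<in> (adj en T)\<^sup>*" using c v unfolding connects_def by blast
  from x(2) v have "x \<in> V - R \<or> (\<exists>e \<in> T. \<exists>r \<in> R. \<exists>s \<in> V - R. en e = {r, s})"
  proof (induction rule: rtrancl_induct)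
    case (step y z)
    then show ?case using T unfolding adj_def by (fastforce simp: insert_commute)
  qed simp
  then show thesis using that x(1) by blast
qed

text \<open>Grow the root set: an edge leaving \<open>R\<close> is selected, its outer end becomes a
  root, and so on. Each selected edge absorbs exactly one vertex of \<open>V - R\<close>.\<close>

lemma connects_subset_card:
  assumes "connects en V R T" "finite V" "R \<subseteq> V" "\<And>e. e \<in> T \<Longrightarrow> en e \<subseteq> V"
  shows "\<exists>S \<subseteq> T. finite S \<and> connects en V R S \<and> card S = card (V - R)"
  using assms
proof (induction "card (V - R)" arbitrary: R T)
  case 0
  then have "V = R" by auto
  then have "connects en V R {}" unfolding connects_def by auto
  then show ?case using 0(1) by force
next
  case (Suc k)
  have "V - R \<noteq> {}" using Suc(2) by (metis card.empty nat.distinct(1))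
  then obtain v where "v \<in> V - R" by blast
  from connects_crossing[OF Suc(3) this Suc(6)] obtain e r s
    where e: "e \<in> T" "en e = {r, s}" "r \<in> R" "s \<in> V - R" by blast
  have c: "connects en V (insert s R) (T - {e})"
    using connects_insert_edge[of e T en r s R V] e Suc(3) by blast
  have k: "V - insert s R = (V - R) - {s}" by auto
  have "k = card (V - insert s R)" using Suc(2) e(4) Suc(4) by (simp add: k)
  from Suc(1)[OF this c Suc(4)] e(4) Suc(5,6) obtain S where
    S: "S \<subseteq> T - {e}" "finite S" "connects en V (insert s R) S" "card S = k" 
    using \<open>k = _\<close> by auto
  have "insert e S - {e} = S" using S(1) by auto
  then have "connects en V R (insert e S)"
    using connects_insert_edge[of e "insert e S" en r s R V] e(2,3) S(3) by simp
  moreover have "card (insert e S) = Suc k" using S by (simp add: subset_Diff_insert)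
  ultimately show ?case using S(1,2) e(1) Suc(2) by (intro exI[of _ "insert e S"]) auto
qed

text \<open>Trades minimality for an edge count, which is easier to follow through deletion and
  contraction. Every connecting set contains one with \<open>card (V - R)\<close> edges, so a
  minimal one has that size, and one of that size cannot lose an edge.\<close>

lemma connects_minimal_iff_card:
  assumes "connects en V R T" "finite V" "R \<subseteq> V" "finite T" "\<And>e. e \<in> T \<Longrightarrow> en e \<subseteq> V"
  shows "(\<forall>e \<in> T. \<not> connects en V R (T - {e})) \<longleftrightarrow> card T = card (V - R)"
proof
  assume m: "\<forall>e \<in> T. \<not> connects en V R (T - {e})"
  obtain S where S: "S \<subseteq> T" "connects en V R S" "card S = card (V - R)"
    using connects_subset_card[OF assms(1-3,5)] by blast
  have "S = T"
  proof (rule ccontr)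
    assume "S \<noteq> T"
    then obtain e where "e \<in> T" "S \<subseteq> T - {e}" using S(1) by blast
    then show False using m connects_mono[OF _ S(2)] by blast
  qed
  then show "card T = card (V - R)" using S(3) by simp
next
  assume k: "card T = card (V - R)"
  show "\<forall>e \<in> T. \<not> connects en V R (T - {e})"
  proof (intro ballI notI)
    fix e assume e: "e \<in> T" and c: "connects en V R (T - {e})"
    obtain S where S: "S \<subseteq> T - {e}" "card S = card (V - R)"
      using connects_subset_card[OF c assms(2,3)] assms(5) by blast
    have "card S < card T" using S(1) e assms(4) by (intro psubset_card_mono) auto
    then show False using k S(2) by simp
  qed
qed

section \<open>Walks and cycles against reachability\<close>

lemma walk_Cons:
  "walk G (a # vs) (e # es) \<longleftrightarrow>
     a \<in> verts G \<and> e \<in> edges G \<and> vs \<noteq> [] \<and> ends G e = {a, hd vs} \<and> walk G vs es"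
proof (cases vs)
  case (Cons b ws)
  then show ?thesis unfolding walk_def by (auto simp: less_Suc_eq_0_disj)
qed (simp add: walk_def)

lemma walk_Nil: "walk G vs [] \<longleftrightarrow> (\<exists>a \<in> verts G. vs = [a])"
  unfolding walk_def by (cases vs) auto

lemma walk_rtrancl:
  "walk G vs es \<Longrightarrow> (hd vs, last vs) \<in> (adj (ends G) (set es))\<^sup>*"
proof (induction es arbitrary: vs)
  case Nil
  then show ?case by (auto simp: walk_Nil)
next
  case (Cons e es)
  then obtain a ws where vs: "vs = a # ws" by (cases vs) (auto simp: walk_def)
  with Cons.prems have w: "ws \<noteq> []" "ends G e = {a, hd ws}" "walk G ws es"
    by (auto simp: walk_Cons)
  have "(a, hd ws) \<in> adj (ends G) (set (e # es))" using w(2) unfolding adj_def by auto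
  moreover have "(hd ws, last ws) \<in> (adj (ends G) (set (e # es)))\<^sup>*"
    using Cons.IH[OF w(3)] rtrancl_mono[OF adj_mono, of "set es" "set (e # es)" "ends G"] by auto
  ultimately show ?case using vs w(1) by (auto intro: converse_rtrancl_into_rtrancl)
qed

lemma walk_ends_subset:
  "walk G vs es \<Longrightarrow> e \<in> set es \<Longrightarrow> ends G e \<subseteq> set vs"
proof (induction es arbitrary: vs)
  case (Cons f es)
  then obtain a ws where vs: "vs = a # ws" by (cases vs) (auto simp: walk_def)
  with Cons.prems have w: "ws \<noteq> []" "ends G f = {a, hd ws}" "walk G ws es"
    by (auto simp: walk_Cons)
  then show ?case using Cons vs by auto
qed simp

lemma walk_distinct_edges:
  "walk G vs es \<Longrightarrow> distinct vs \<Longrightarrow> distinct es"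
proof (induction es arbitrary: vs)
  case (Cons e es)
  then obtain a ws where vs: "vs = a # ws" by (cases vs) (auto simp: walk_def)
  then show ?case using Cons walk_ends_subset[of G ws es e] by (auto simp: walk_Cons)
qed simp

text \<open>Keeps walks simple: when the vertex to be prepended already occurs,
  \<open>rtrancl_walk\<close> restarts the walk at that occurrence.\<close>

lemma walk_suffix:
  "walk G vs es \<Longrightarrow> a \<in> set vs \<Longrightarrow>
     \<exists>vs' es'. walk G vs' es' \<and> hd vs' = a \<and> last vs' = last vs \<and> (distinct vs \<longrightarrow> distinct vs')"
proof (induction es arbitrary: vs)
  case Nil
  then show ?case by (intro exI[of _ vs] exI[of _ "[]"]) (auto simp: walk_Nil)
next
  case (Cons e es)
  then obtain b ws where vs: "vs = b # ws" by (cases vs) (auto simp: walk_def)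
  with Cons.prems have w: "ws \<noteq> []" "walk G ws es" by (auto simp: walk_Cons)
  show ?case
  proof (cases "a = b")
    case True
    then show ?thesis using Cons.prems vs by (intro exI[of _ vs] exI[of _ "e # es"]) auto
  next
    case False
    then show ?thesis using Cons.IH[OF w(2)] Cons.prems vs w(1) by auto
  qed
qed

lemma rtrancl_walk:
  assumes "(a, b) \<in> (adj (ends G) (edges G))\<^sup>*" "b \<in> verts G"
    "\<And>e. e \<in> edges G \<Longrightarrow> ends G e \<subseteq> verts G"
  shows "\<exists>vs es. walk G vs es \<and> hd vs = a \<and> last vs = b \<and> distinct vs"
  using assms(1)
proof (induction rule: converse_rtrancl_induct)
  case base
  show ?case using assms(2) by (intro exI[of _ "[b]"] exI[of _ "[]"]) (auto simp: walk_Nil)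
next
  case (step y z)
  then obtain vs es where w: "walk G vs es" "hd vs = z" "last vs = b" "distinct vs" by blast
  obtain e where e: "e \<in> edges G" "ends G e = {y, z}" using step(1) unfolding adj_def by auto
  have ne: "vs \<noteq> []" using w(1) by (auto simp: walk_def)
  show ?case
  proof (cases "y \<in> set vs")
    case True
    from walk_suffix[OF w(1) this] w(3,4) show ?thesis by metis
  next
    case False
    have "walk G (y # vs) (e # es)" using e assms(3)[OF e(1)] w(1,2) ne by (auto simp: walk_Cons)
    then show ?thesis using w(3,4) False ne
      by (intro exI[of _ "y # vs"] exI[of _ "e # es"]) auto
  qed
qed

definition finite_multigraph :: "('v, 'e) multigraph \<Rightarrow> bool" where
  "finite_multigraph G \<longleftrightarrow> finite (verts G) \<and> finite (edges G) \<and>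
     (\<forall>e \<in> edges G. \<exists>a \<in> verts G. \<exists>b \<in> verts G. ends G e = {a, b})"

lemma finite_multigraphD:
  assumes "finite_multigraph G"
  shows "finite (verts G)" "finite (edges G)" "e \<in> edges G \<Longrightarrow> ends G e \<subseteq> verts G"
  using assms unfolding finite_multigraph_def by auto

text \<open>With \<open>UNIV\<close> on the right the second conjunct does not depend on
  \<open>T\<close>, so walks in subgraphs with different edge sets become comparable.\<close>

lemma walk_edges_update:
  "walk (G\<lparr>edges := T\<rparr>) vs es \<longleftrightarrow> set es \<subseteq> T \<and> walk (G\<lparr>edges := UNIV\<rparr>) vs es"
  unfolding walk_def by auto

text \<open>An edge lies on a cycle iff its ends stay connected without it: a simple path between
  them, closed up by the edge, is a cycle. Loops are covered by the reflexive case of the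
  closure.\<close>

lemma acyclic_iff:
  assumes G: "finite_multigraph G" and T: "T \<subseteq> edges G"
  shows "(\<nexists>vs es. cycle (G\<lparr>edges := T\<rparr>) vs es) \<longleftrightarrow>
    (\<forall>e \<in> T. \<forall>a b. ends G e = {a, b} \<longrightarrow> (b, a) \<notin> (adj (ends G) (T - {e}))\<^sup>*)"
    (is "?A \<longleftrightarrow> ?B")
proof
  assume A: ?A
  show ?B
  proof (intro ballI allI impI notI)
    fix e a b
    assume e: "e \<in> T" "ends G e = {a, b}" and r: "(b, a) \<in> (adj (ends G) (T - {e}))\<^sup>*"
    have ab: "a \<in> verts G" "b \<in> verts G"
      using e finite_multigraphD(3)[OF G, of e] T by auto
    have "\<exists>vs es. walk (G\<lparr>edges := T - {e}\<rparr>) vs es \<and> hd vs = b \<and> last vs = a \<and> distinct vs"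
      using r ab T finite_multigraphD(3)[OF G] by (intro rtrancl_walk) auto
    then obtain vs es where w: "walk (G\<lparr>edges := T - {e}\<rparr>) vs es" "hd vs = b" "last vs = a"
      "distinct vs" by blast
    have ne: "vs \<noteq> []" using w(1) by (auto simp: walk_def)
    have "walk (G\<lparr>edges := T\<rparr>) vs es"
      using w(1) walk_edges_update[of "T - {e}" G vs es] walk_edges_update[of T G vs es] by auto
    then have "walk (G\<lparr>edges := T\<rparr>) (a # vs) (e # es)"
      using e ab w(2) ne by (auto simp: walk_Cons)
    moreover have "e \<notin> set es" using w(1) by (auto simp: walk_def)
    ultimately have "cycle (G\<lparr>edges := T\<rparr>) (a # vs) (e # es)"
      unfolding cycle_def using walk_distinct_edges[OF w(1,4)] w(3,4) ne by auto
    then show False using A by blast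
  qed
next
  assume B: ?B
  show ?A
  proof (intro notI, elim exE)
    fix vs es assume c: "cycle (G\<lparr>edges := T\<rparr>) vs es"
    then obtain e fs where es: "es = e # fs" unfolding cycle_def by (cases es) auto
    from c es obtain a ws where vs: "vs = a # ws"
      unfolding cycle_def by (cases vs) (auto simp: walk_def)
    have w: "e \<in> T" "ws \<noteq> []" "ends G e = {a, hd ws}" "walk (G\<lparr>edges := T\<rparr>) ws fs"
      "last ws = a" "e \<notin> set fs"
      using c unfolding cycle_def es vs walk_Cons by (auto split: if_splits)
    have "set fs \<subseteq> T - {e}" using w(4,6) by (auto simp: walk_def)
    then have "(hd ws, a) \<in> (adj (ends G) (T - {e}))\<^sup>*"
      using walk_rtrancl[OF w(4)] w(5) rtrancl_mono[OF adj_mono[of "set fs" "T - {e}" "ends G"]]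
      by auto
    then show False using B w(1,3) by blast
  qed
qed

lemma tree_iff:
  assumes G: "finite_multigraph G" and T: "T \<subseteq> edges G" and r: "r \<in> verts G"
  shows "tree (G\<lparr>edges := T\<rparr>) \<longleftrightarrow>
    connects (ends G) (verts G) {r} T \<and> card T = card (verts G - {r})"
proof -
  let ?H = "G\<lparr>edges := T\<rparr>" and ?R = "\<lambda>S. (adj (ends G) S)\<^sup>*"
  have conn: "connected_graph ?H \<longleftrightarrow> connects (ends G) (verts G) {r} T"
  proof
    assume c: "connected_graph ?H"
    show "connects (ends G) (verts G) {r} T" unfolding connects_def
    proof
      fix v assume "v \<in> verts G"
      then obtain vs es where w: "walk ?H vs es" "hd vs = v" "last vs = r"
        using c r unfolding connected_graph_def by fastforce
      have "set es \<subseteq> T" using w(1) by (auto simp: walk_def)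
      then show "\<exists>r \<in> {r}. (v, r) \<in> ?R T"
        using walk_rtrancl[OF w(1)] w(2,3) rtrancl_mono[OF adj_mono[of "set es" T "ends G"]] by auto
    qed
  next
    assume c: "connects (ends G) (verts G) {r} T"
    show "connected_graph ?H" unfolding connected_graph_def
    proof (intro conjI ballI)
      show "verts ?H \<noteq> {}" using r by auto
      fix u v assume uv: "u \<in> verts ?H" "v \<in> verts ?H"
      then have "(u, r) \<in> ?R T" "(v, r) \<in> ?R T" using c unfolding connects_def by auto
      then have "(u, v) \<in> ?R T" by (meson adj_rtrancl_sym rtrancl_trans)
      then show "\<exists>vs es. walk ?H vs es \<and> hd vs = u \<and> last vs = v"
        using rtrancl_walk[of u v ?H] uv finite_multigraphD(3)[OF G] T by auto
    qed
  qed
  \<comment> \<open>Lying on a cycle amounts to being redundant for connectivity: every use of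
    \<open>e\<close> can be replaced by the detour. Acyclicity thus becomes minimality.\<close>
  have step: "(\<exists>a b. ends G e = {a, b} \<and> (b, a) \<in> ?R (T - {e})) \<longleftrightarrow>
      connects (ends G) (verts G) {r} (T - {e})"
    if c: "connects (ends G) (verts G) {r} T" and e: "e \<in> T" for e
  proof
    assume "\<exists>a b. ends G e = {a, b} \<and> (b, a) \<in> ?R (T - {e})"
    then obtain a b where ab: "ends G e = {a, b}" "(b, a) \<in> ?R (T - {e})" by blast
    have "adj (ends G) T \<subseteq> ?R (T - {e})"
    proof
      fix p assume p: "p \<in> adj (ends G) T"
      then obtain u v f where f: "p = (u, v)" "f \<in> T" "ends G f = {u, v}"
        unfolding adj_def by auto
      show "p \<in> ?R (T - {e})"
      proof (cases "f = e")
        case True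
        then have "u = a \<and> v = b \<or> u = b \<and> v = a" using f ab(1) by (auto simp: doubleton_eq_iff)
        then show ?thesis using ab(2) adj_rtrancl_sym f(1) by fastforce
      next
        case False
        then have "p \<in> adj (ends G) (T - {e})" using f unfolding adj_def by auto
        then show ?thesis by auto
      qed
    qed
    then have "?R T \<subseteq> ?R (T - {e})" by (metis rtrancl_mono rtrancl_idemp)
    then show "connects (ends G) (verts G) {r} (T - {e})" using c unfolding connects_def by blast
  next
    assume c': "connects (ends G) (verts G) {r} (T - {e})"
    obtain a b where ab: "ends G e = {a, b}" "a \<in> verts G" "b \<in> verts G"
      using e T G unfolding finite_multigraph_def by blast
    then have "(a, r) \<in> ?R (T - {e})" "(b, r) \<in> ?R (T - {e})" using c' unfolding connects_def by auto
    then have "(b, a) \<in> ?R (T - {e})" by (meson adj_rtrancl_sym rtrancl_trans)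
    then show "\<exists>a b. ends G e = {a, b} \<and> (b, a) \<in> ?R (T - {e})" using ab by blast
  qed
  have fin: "finite (verts G)" "finite T" "\<And>e. e \<in> T \<Longrightarrow> ends G e \<subseteq> verts G"
    using finite_multigraphD[OF G] T finite_subset by auto
  show ?thesis
  proof (cases "connects (ends G) (verts G) {r} T")
    case True
    then have "tree ?H \<longleftrightarrow> (\<forall>e \<in> T. \<not> connects (ends G) (verts G) {r} (T - {e}))"
      unfolding tree_def acyclic_iff[OF G T] using conn step[OF True] by blast
    then show ?thesis using True connects_minimal_iff_card[OF True fin(1) _ fin(2,3)] r by auto
  next
    case False
    then show ?thesis unfolding tree_def conn by blast
  qed
qed

section \<open>The matrix-tree theorem\<close>

text \<open>Phrased through entries that differ in row \<open>k\<close> only, because both the edge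
  recursion and the later correction of the Laplacian modify a single row.\<close>

lemma det_row_linear:
  fixes a :: "nat \<Rightarrow> nat \<Rightarrow> 'a :: comm_ring_1"
  assumes k: "k < n"
  shows "Determinant.det (mat n n (\<lambda>(i, j). if i = k then b j + c * d j else a i j)) =
    Determinant.det (mat n n (\<lambda>(i, j). if i = k then b j else a i j)) +
    c * Determinant.det (mat n n (\<lambda>(i, j). if i = k then d j else a i j))"
proof -
  let ?U = "{0..<n}"
  have e: "Determinant.det (mat n n (\<lambda>(i, j). if i = k then g j else a i j)) =
      (\<Sum>p\<in>{p. p permutes ?U}. signof p * (g (p k) * (\<Prod>i\<in>?U - {k}. a i (p i))))" for g
  proof -
    have "Determinant.det (mat n n (\<lambda>(i, j). if i = k then g j else a i j)) =
      (\<Sum>p\<in>{p. p permutes ?U}. signof p *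
         (\<Prod>i\<in>?U. mat n n (\<lambda>(i, j). if i = k then g j else a i j) $$ (i, p i)))"
      by (simp add: det_def)
    also have "\<dots> = (\<Sum>p\<in>{p. p permutes ?U}. signof p * (g (p k) * (\<Prod>i\<in>?U - {k}. a i (p i))))"
    proof (intro sum.cong refl arg_cong2[of _ _ _ _ "(*)"])
      fix p assume "p \<in> {p. p permutes ?U}"
      then have p: "p i < n" if "i < n" for i using that by (auto dest: permutes_in_image[of p ?U i])
      have "(\<Prod>i\<in>?U. mat n n (\<lambda>(i, j). if i = k then g j else a i j) $$ (i, p i)) =
         (\<Prod>i\<in>?U. if i = k then g (p i) else a i (p i))"
        using p by (intro prod.cong) auto
      also have "\<dots> = g (p k) * (\<Prod>i\<in>?U - {k}. a i (p i))"
        using k by (subst prod.remove[of _ k]) (auto intro!: prod.cong)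
      finally show "(\<Prod>i\<in>?U. mat n n (\<lambda>(i, j). if i = k then g j else a i j) $$ (i, p i)) =
        g (p k) * (\<Prod>i\<in>?U - {k}. a i (p i))" .
    qed
    finally show ?thesis .
  qed
  show ?thesis unfolding e
    by (simp add: algebra_simps sum.distrib sum_distrib_left)
qed

lemma det_zero_if_kernel:
  fixes a :: "nat \<Rightarrow> nat \<Rightarrow> real"
  assumes "\<And>i. i < n \<Longrightarrow> (\<Sum>j<n. a i j * x j) = 0" "k < n" "x k \<noteq> 0"
  shows "Determinant.det (mat n n (\<lambda>(i, j). a i j)) = 0"
proof -
  let ?A = "mat n n (\<lambda>(i, j). a i j)" and ?v = "vec n x"
  have "?A *\<^sub>v ?v = 0\<^sub>v n"
    using assms(1) by (intro eq_vecI) (auto simp: scalar_prod_def atLeast0LessThan)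
  moreover have "?v \<noteq> 0\<^sub>v n" using assms(2,3) by (metis index_vec index_zero_vec(1))
  ultimately show ?thesis
    using det_0_iff_vec_prod_zero[of ?A n] mat_carrier vec_carrier by blast
qed

text \<open>The inner sum runs over all ends of \<open>e\<close>; the end \<open>u\<close>
  contributes 0. So the opposite end need not be singled out, and loops drop out by
  themselves.\<close>

definition laplacian :: "('e \<Rightarrow> 'v set) \<Rightarrow> 'e set \<Rightarrow> ('v \<Rightarrow> real) \<Rightarrow> 'v \<Rightarrow> real" where
  "laplacian en E f u = (\<Sum>e \<in> {e \<in> E. u \<in> en e}. \<Sum>w \<in> en e. f u - f w)"

text \<open>Identifies the operator with the matrix whose entries are its values on
  indicators.\<close>

lemma laplacian_indicator_sum:
  assumes V: "finite V" and E: "\<And>e. e \<in> E \<Longrightarrow> en e \<subseteq> V"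
  shows "(\<Sum>w \<in> V. laplacian en E (indicator {w}) u * f w) = laplacian en E f u"
proof -
  have f: "f x = (\<Sum>w \<in> V. indicator {w} x * f w)" if "x \<in> V" for x
    using that V by (simp add: indicator_def sum.delta if_distrib[of "\<lambda>t. t * _"] cong: if_cong)
  have "(\<Sum>w \<in> V. laplacian en E (indicator {w}) u * f w) =
      (\<Sum>w \<in> V. \<Sum>e \<in> {e \<in> E. u \<in> en e}. \<Sum>x \<in> en e. (indicator {w} u - indicator {w} x) * f w)"
    unfolding laplacian_def by (simp add: sum_distrib_right)
  also have "\<dots> = (\<Sum>e \<in> {e \<in> E. u \<in> en e}. \<Sum>x \<in> en e. \<Sum>w \<in> V. (indicator {w} u - indicator {w} x) * f w)"
    by (subst sum.swap, rule sum.cong[OF refl], rule sum.swap)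
  also have "\<dots> = laplacian en E f u"
    unfolding laplacian_def
  proof (intro sum.cong refl)
    fix e x assume "e \<in> {e \<in> E. u \<in> en e}" "x \<in> en e"
    then have "u \<in> V" "x \<in> V" using E by auto
    then show "(\<Sum>w \<in> V. (indicator {w} u - indicator {w} x) * f w) = f u - f x"
      using f[of u] f[of x] by (simp add: left_diff_distrib sum_subtractf)
  qed
  finally show ?thesis .
qed

lemma laplacian_remove_edge:
  assumes E: "finite E" "e \<in> E" and e: "en e = {r, s}" "r \<noteq> s"
  shows "laplacian en E f u = laplacian en (E - {e}) f u +
    (if u = s then f s - f r else if u = r then f r - f s else 0)"
proof (cases "u \<in> en e")
  case True
  then have s: "{e' \<in> E. u \<in> en e'} = insert e {e' \<in> E - {e}. u \<in> en e'}" using E by auto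
  have "laplacian en E f u = (\<Sum>w \<in> en e. f u - f w) + laplacian en (E - {e}) f u"
    unfolding laplacian_def s using E by (subst sum.insert) auto
  then show ?thesis using e True by auto
next
  case False
  then have "{e' \<in> E. u \<in> en e'} = {e' \<in> E - {e}. u \<in> en e'}" by auto
  then show ?thesis using False e unfolding laplacian_def by auto
qed

text \<open>Instead of deleting the rows and columns of the root set \<open>R\<close>, its rows are replaced by
  those of the identity, so that the dimension does not depend on \<open>R\<close>.\<close>

definition rooted_entry ::
    "(nat \<Rightarrow> 'v) \<Rightarrow> ('e \<Rightarrow> 'v set) \<Rightarrow> 'e set \<Rightarrow> 'v set \<Rightarrow> nat \<Rightarrow> nat \<Rightarrow> real" where
  "rooted_entry h en E R i j =
     (if h i \<in> R then if i = j then 1 else 0 else laplacian en E (indicator {h j}) (h i))"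

abbreviation rooted_det where
  "rooted_det n h en E R \<equiv> Determinant.det (mat n n (\<lambda>(i, j). rooted_entry h en E R i j))"

text \<open>Deleting \<open>e\<close> changes only the row of \<open>s\<close>, since the row of the
  root \<open>r\<close> is a unit row; the change is the unit vector at \<open>s\<close> minus the
  one at \<open>r\<close>. By linearity the first turns \<open>s\<close> into a root, and the second
  repeats the row of \<open>r\<close>, so its determinant vanishes.\<close>

lemma rooted_det_edge:
  assumes h: "bij_betw h {0..<n} V" and E: "finite E" "e \<in> E"
    and e: "en e = {r, s}" "r \<in> R" "s \<in> V - R" and R: "R \<subseteq> V"
  shows "rooted_det n h en E R = rooted_det n h en (E - {e}) R + rooted_det n h en (E - {e}) (insert s R)"
proof -
  have inj: "h i = h j \<longleftrightarrow> i = j" if "i < n" "j < n" for i j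
    using h that unfolding bij_betw_def inj_on_def by auto
  obtain k l where k: "k < n" "h k = s" and l: "l < n" "h l = r"
  proof -
    have "s \<in> h ` {0..<n}" "r \<in> h ` {0..<n}" using h e R unfolding bij_betw_def by auto
    then show ?thesis using that by auto
  qed
  have kl: "k \<noteq> l" using e k l by auto
  have rs: "r \<noteq> s" using e by auto
  let ?a = "rooted_entry h en (E - {e}) R" and ?D = "\<lambda>i j. if i = j then 1 else 0 :: real"
  have A: "mat n n (\<lambda>(i, j). rooted_entry h en E R i j) =
      mat n n (\<lambda>(i, j). if i = k then (?a k j + 1 * ?D k j) + (- 1) * ?D l j else ?a i j)"
  proof (intro cong_mat refl, unfold prod.case)
    fix i j assume ij: "i < n" "j < n"
    show "rooted_entry h en E R i j =
        (if i = k then (?a k j + 1 * ?D k j) + (- 1) * ?D l j else ?a i j)"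
    proof (cases "h i \<in> R")
      case True
      then show ?thesis using e(3) k by (auto simp: rooted_entry_def)
    next
      case False
      have "h i = s \<longleftrightarrow> i = k" "h i \<noteq> r" using inj[OF ij(1) k(1)] k False e(2) by auto
      moreover have "indicator {h j} s = ?D k j" "indicator {h j} r = ?D l j"
        using inj[OF k(1) ij(2)] inj[OF l(1) ij(2)] k l by (auto simp: indicator_def)
      ultimately show ?thesis
        using False by (auto simp: rooted_entry_def laplacian_remove_edge[of E e en r s, OF E e(1) rs])
    qed
  qed
  have D2: "mat n n (\<lambda>(i, j). if i = k then ?D k j else ?a i j) =
      mat n n (\<lambda>(i, j). rooted_entry h en (E - {e}) (insert s R) i j)"
    using inj k e unfolding rooted_entry_def by (intro cong_mat refl) auto
  have D3: "Determinant.det (mat n n (\<lambda>(i, j). if i = k then ?D l j else ?a i j)) = 0"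
    using k l kl e
    by (intro det_identical_rows[of _ n k l]) (auto simp: rooted_entry_def intro!: eq_vecI)
  have D1: "mat n n (\<lambda>(i, j). if i = k then ?a k j else ?a i j) = mat n n (\<lambda>(i, j). ?a i j)"
    by (intro cong_mat refl) auto
  show ?thesis unfolding A det_row_linear[OF k(1)] D3 D2 D1 by simp
qed

text \<open>The indicator of \<open>V - R\<close> is a nonzero kernel vector: it vanishes on the
  root rows and is constant along every edge.\<close>

lemma rooted_det_no_crossing:
  assumes V: "finite V" and h: "bij_betw h {0..<n} V" and v: "v \<in> V - R"
    and E: "\<And>e. e \<in> E \<Longrightarrow> en e \<subseteq> V - R \<or> en e \<subseteq> R" and R: "R \<subseteq> V"
  shows "rooted_det n h en E R = 0"
proof -
  have sub: "en e \<subseteq> V" if "e \<in> E" for e using E[OF that] R by blast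
  obtain k where k: "k < n" "h k = v" using h v unfolding bij_betw_def by force
  let ?x = "indicator (V - R) :: 'a \<Rightarrow> real"
  have ker: "(\<Sum>j<n. rooted_entry h en E R i j * ?x (h j)) = 0" if i: "i < n" for i
  proof (cases "h i \<in> R")
    case True
    then have "rooted_entry h en E R i j * ?x (h j) = 0" for j
      by (auto simp: rooted_entry_def indicator_def)
    then show ?thesis by (intro sum.neutral ballI)
  next
    case False
    have "(\<Sum>j<n. rooted_entry h en E R i j * ?x (h j)) =
        (\<Sum>j\<in>{0..<n}. laplacian en E (indicator {h j}) (h i) * ?x (h j))"
      using False by (simp add: rooted_entry_def atLeast0LessThan)
    also have "\<dots> = (\<Sum>w\<in>V. laplacian en E (indicator {w}) (h i) * ?x w)"
      by (rule sum.reindex_bij_betw[OF h])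
    also have "\<dots> = laplacian en E ?x (h i)"
      by (rule laplacian_indicator_sum[OF V sub])
    also have "\<dots> = 0" unfolding laplacian_def
    proof (intro sum.neutral ballI)
      fix e w assume "e \<in> {e \<in> E. h i \<in> en e}" "w \<in> en e"
      then have "h i \<in> V - R" "w \<in> V - R" using E[of e] False by auto
      then show "?x (h i) - ?x w = 0" by simp
    qed
    finally show ?thesis .
  qed
  show ?thesis
  proof (rule det_zero_if_kernel[of n "rooted_entry h en E R" "\<lambda>j. ?x (h j)" k])
    show "?x (h k) \<noteq> 0" using k(2) v by simp
  qed (rule ker k(1), assumption?)+
qed

text \<open>For finite \<open>V\<close>, \<open>R \<subseteq> V\<close> and edges inside
  \<open>V\<close>, these are the spanning forests each of whose trees contains exactly one root;
  the edge count stands in for acyclicity.\<close>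

definition rooted_forests :: "('e \<Rightarrow> 'v set) \<Rightarrow> 'v set \<Rightarrow> 'e set \<Rightarrow> 'v set \<Rightarrow> 'e set set" where
  "rooted_forests en V E R = {T. T \<subseteq> E \<and> connects en V R T \<and> card T = card (V - R)}"

text \<open>Deletion and contraction: forests without \<open>e\<close> survive its deletion, while
  removing \<open>e\<close> from one that uses it cuts off a part that \<open>s\<close> now
  roots.\<close>

lemma rooted_forests_edge:
  assumes V: "finite V" and E: "finite E" "e \<in> E"
    and e: "en e = {r, s}" "r \<in> R" "s \<in> V - R"
  shows "rooted_forests en V E R =
    rooted_forests en V (E - {e}) R \<union> insert e ` rooted_forests en V (E - {e}) (insert s R)"
    (is "?L = ?A \<union> insert e ` ?B")
proof -
  have k: "card (V - R) = Suc (card (V - insert s R))"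
  proof -
    have "V - R = insert s (V - insert s R)" using e(3) by auto
    then have "card (V - R) = card (insert s (V - insert s R))" by (rule arg_cong)
    then show ?thesis
      using V by (simp only: card_insert_disjoint finite_Diff Diff_iff insert_iff simp_thms)
  qed
  have with_e: "T \<in> ?L \<longleftrightarrow> T - {e} \<in> ?B" if "e \<in> T" "T \<subseteq> E" for T
  proof -
    have "finite T" using that E finite_subset by blast
    then have "card T = Suc (card (T - {e}))" by (rule card.remove[OF _ that(1)])
    moreover have "connects en V (insert s R) (T - {e}) \<longleftrightarrow> connects en V R T"
      by (rule connects_insert_edge) (use that e in auto)
    moreover have "T - {e} \<subseteq> E - {e}" using that by blast
    ultimately show ?thesis
      unfolding rooted_forests_def mem_Collect_eq k using that(2) by (simp only: simp_thms nat.inject)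
  qed
  have without_e: "T \<in> ?L \<longleftrightarrow> T \<in> ?A" if "e \<notin> T" for T
    unfolding rooted_forests_def mem_Collect_eq using that by blast
  show ?thesis
  proof (intro Set.set_eqI iffI)
    fix T assume T: "T \<in> ?L"
    show "T \<in> ?A \<union> insert e ` ?B"
    proof (cases "e \<in> T")
      case True
      have "T - {e} \<in> ?B" using T with_e[OF True] unfolding rooted_forests_def by blast
      then have "insert e (T - {e}) \<in> insert e ` ?B" by (rule imageI)
      then show ?thesis using True by (simp only: insert_Diff UnI2)
    next
      case False
      then show ?thesis using T without_e by blast
    qed
  next
    fix T assume "T \<in> ?A \<union> insert e ` ?B"
    then show "T \<in> ?L"
    proof
      assume T: "T \<in> ?A"
      then have "e \<notin> T" unfolding rooted_forests_def by blast
      then show ?thesis using T without_e by blast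
    next
      assume "T \<in> insert e ` ?B"
      then obtain S where S: "T = insert e S" "S \<in> ?B" by (rule imageE)
      then have "S \<subseteq> E - {e}" unfolding rooted_forests_def by blast
      then have "insert e S - {e} = S" "insert e S \<subseteq> E" using E by blast+
      then show ?thesis using with_e[of "insert e S"] S by simp
    qed
  qed
qed

lemma card_rooted_forests_edge:
  assumes "finite V" "finite E" "e \<in> E" "en e = {r, s}" "r \<in> R" "s \<in> V - R"
  shows "card (rooted_forests en V E R) = card (rooted_forests en V (E - {e}) R) +
    card (rooted_forests en V (E - {e}) (insert s R))"
proof -
  let ?A = "rooted_forests en V (E - {e}) R" and ?B = "rooted_forests en V (E - {e}) (insert s R)"
  have fin: "finite (rooted_forests en V (E - {e}) R')" for R'
  proof (rule finite_subset)
    show "rooted_forests en V (E - {e}) R' \<subseteq> Pow E" unfolding rooted_forests_def by blast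
    show "finite (Pow E)" using assms(2) by simp
  qed
  have notin: "e \<notin> T" if "T \<in> rooted_forests en V (E - {e}) R'" for T R'
  proof -
    have "T \<subseteq> E - {e}" using that unfolding rooted_forests_def by simp
    then show ?thesis by blast
  qed
  have "e \<in> T" if "T \<in> insert e ` ?B" for T using that by auto
  then have "?A \<inter> insert e ` ?B = {}" using notin[of _ R] by (intro equals0I) (meson IntD1 IntD2)
  then have "card (?A \<union> insert e ` ?B) = card ?A + card (insert e ` ?B)"
    by (rule card_Un_disjoint[OF fin finite_imageI[OF fin]])
  moreover have "rooted_forests en V E R = ?A \<union> insert e ` ?B"
    by (rule rooted_forests_edge) (rule assms)+
  moreover have "inj_on (insert e) ?B" using notin by (intro inj_onI) (metis insert_ident)
  ultimately show ?thesis by (simp only: card_image)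
qed

text \<open>Both sides obey the same recursion along an edge between \<open>R\<close> and
  \<open>V - R\<close>. Once no such edge is left, both are 1 if \<open>V = R\<close> and 0
  otherwise.\<close>

theorem rooted_matrix_tree:
  assumes V: "finite V" and h: "bij_betw h {0..<n} V" and "finite E"
    and "\<And>e. e \<in> E \<Longrightarrow> \<exists>a \<in> V. \<exists>b \<in> V. en e = {a, b}" and "R \<subseteq> V"
  shows "rooted_det n h en E R = real (card (rooted_forests en V E R))"
  using assms(3-5)
proof (induction "card E" arbitrary: E R rule: less_induct)
  case (less E R)
  have sub: "en e \<subseteq> V" if "e \<in> E" for e using less.prems(2)[OF that] by auto
  have hV: "h i \<in> V" if "i < n" for i using h that unfolding bij_betw_def by auto
  show ?case
  proof (cases "\<exists>e \<in> E. \<exists>r \<in> R. \<exists>s \<in> V - R. en e = {r, s}")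
    case True
    then obtain e r s where e: "e \<in> E" "r \<in> R" "s \<in> V - R" "en e = {r, s}" by blast
    have lt: "card (E - {e}) < card E" by (rule card_Diff1_less[OF less.prems(1) e(1)])
    have IH: "rooted_det n h en (E - {e}) R' = real (card (rooted_forests en V (E - {e}) R'))"
      if "R' \<subseteq> V" for R'
      by (rule less.hyps[OF lt]) (use less.prems(1,2) that in blast)+
    show ?thesis
      unfolding card_rooted_forests_edge[of V E e en r s R, OF V less.prems(1) e(1,4,2,3)]
        rooted_det_edge[of h n V E e en r s R, OF h less.prems(1) e(1) e(4,2,3) less.prems(3)]
      using IH[OF less.prems(3)] IH[of "insert s R"] less.prems(3) e(3) by simp
  next
    case no: False
    show ?thesis
    proof (cases "V = R")
      case True
      have "mat n n (\<lambda>(i, j). rooted_entry h en E R i j) = 1\<^sub>m n"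
        using hV True unfolding rooted_entry_def by (intro eq_matI) auto
      moreover have "rooted_forests en V E R = {{}}"
      proof -
        have "card T = card (V - V) \<longleftrightarrow> T = {}" if "T \<subseteq> E" for T
          using card_0_eq[OF finite_subset[OF that less.prems(1)]] by simp
        moreover have "connects en V V T" for T unfolding connects_def by blast
        ultimately show ?thesis unfolding rooted_forests_def True[symmetric] by blast
      qed
      ultimately show ?thesis by simp
    next
      case False
      then obtain v where v: "v \<in> V - R" using less.prems(3) by blast
      have "rooted_forests en V E R = {}" unfolding rooted_forests_def
      proof (intro equals0I, elim CollectE conjE)
        fix T assume T: "T \<subseteq> E" "connects en V R T"
        show False
        proof (rule connects_crossing[OF T(2) v])
          show "en e \<subseteq> V" if "e \<in> T" for e using T(1) that sub by blast
        next
          fix e r s assume "e \<in> T" "en e = {r, s}" "r \<in> R" "s \<in> V - R"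
          then show False using no T(1) by (metis subsetD)
        qed
      qed
      moreover have "rooted_det n h en E R = 0"
      proof (rule rooted_det_no_crossing[OF V h v])
        fix e assume e: "e \<in> E"
        then obtain a b where ab: "en e = {a, b}" "a \<in> V" "b \<in> V" using less.prems(2) by blast
        have cross: "\<not> (r \<in> R \<and> s \<in> V - R)" if "en e = {r, s}" for r s
          using no e that by metis
        have "en e = {b, a}" unfolding ab(1) by (rule insert_commute)
        from cross[OF ab(1)] cross[OF this] ab(2,3)
        show "en e \<subseteq> V - R \<or> en e \<subseteq> R" unfolding ab(1) by auto
      qed (rule less.prems(3))
      ultimately show ?thesis by (simp only: card.empty of_nat_0)
    qed
  qed
qed

corollary matrix_tree:
  assumes G: "finite_multigraph G" and h: "bij_betw h {0..<n} (verts G)" and r: "r \<in> verts G"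
  shows "rooted_det n h (ends G) (edges G) {r} = real (num_spanning_trees G)"
proof -
  have "spanning_trees G = rooted_forests (ends G) (verts G) (edges G) {r}"
    unfolding spanning_trees_def rooted_forests_def
    by (intro Collect_cong conj_cong refl tree_iff[OF G _ r])
  moreover have "rooted_det n h (ends G) (edges G) {r} =
      real (card (rooted_forests (ends G) (verts G) (edges G) {r}))"
    using G r unfolding finite_multigraph_def by (intro rooted_matrix_tree[OF _ h]) auto
  ultimately show ?thesis unfolding num_spanning_trees_def by (simp only:)
qed

section \<open>Spanning trees from an orthogonal eigenbasis\<close>

lemma mat_mult_mat:
  "mat n n (\<lambda>(i, j). a i j) * mat n n (\<lambda>(i, j). b i j) =
    mat n n (\<lambda>(i, j). \<Sum>k<n. a i k * (b k j :: 'a :: semiring_0))"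
  by (intro eq_matI) (auto simp: scalar_prod_def atLeast0LessThan)

lemma det_mult3:
  fixes A B C :: "'a :: comm_ring_1 mat"
  assumes "A \<in> carrier_mat n n" "B \<in> carrier_mat n n" "C \<in> carrier_mat n n"
  shows "Determinant.det (A * (B * C)) =
    Determinant.det A * (Determinant.det B * Determinant.det C)"
  using assms by (simp add: det_mult[of _ n])

text \<open>Places the constant mode at index 0, so that the exceptional column of the transformed
  Laplacian comes first and the matrix is lower triangular.\<close>

lemma ex_bij_betw_nat_finite_hd:
  assumes I: "finite I" "a \<in> I"
  obtains g where "bij_betw g {0..<card I} I" "g 0 = a"
proof -
  obtain f where f: "bij_betw f {0..<card I} I" using ex_bij_betw_nat_finite[OF I(1)] ..
  have "a \<in> f ` {0..<card I}" using I(2) bij_betw_imp_surj_on[OF f] by simp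
  then obtain k where k: "k \<in> {0..<card I}" "a = f k" by blast
  have "Transposition.transpose 0 k permutes {0..<card I}"
    using k(1) by (intro permutes_swap_id) auto
  then have "bij_betw (f \<circ> Transposition.transpose 0 k) {0..<card I} I"
    by (rule bij_betw_trans[OF permutes_imp_bij f])
  moreover have "(f \<circ> Transposition.transpose 0 k) 0 = a" using k(2) by simp
  ultimately show thesis using that by blast
qed

lemma laplacian_const:
  assumes "\<And>v. v \<in> V \<Longrightarrow> f v = c" "\<And>e. e \<in> E \<Longrightarrow> en e \<subseteq> V"
  shows "laplacian en E f u = 0"
  unfolding laplacian_def
proof (intro sum.neutral ballI)
  fix e w assume "e \<in> {e \<in> E. u \<in> en e}" "w \<in> en e"
  then have "u \<in> V" "w \<in> V" using assms(2) by auto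
  then show "f u - f w = 0" using assms(1) by simp
qed

text \<open>Let E be the matrix of modes and M the Laplacian with the weights added to row 0. Then
  det M is the total weight times the number of trees. E^T M E is triangular and E^T diag(w) E is
  diagonal; their diagonals differ exactly by the factors \<open>lam i\<close> for
  \<open>i \<noteq> i0\<close>, so the quotient of the determinants gives the claim.\<close>

theorem spanning_trees_eigenbasis:
  fixes G :: "('v, 'e) multigraph" and F :: "'i \<Rightarrow> 'v \<Rightarrow> real" and w :: "'v \<Rightarrow> real"
  assumes G: "finite_multigraph G"
    and I: "finite I" "card I = card (verts G)" "i0 \<in> I"
    and const: "\<And>v. v \<in> verts G \<Longrightarrow> F i0 v = 1"
    and orth: "\<And>i k. i \<in> I \<Longrightarrow> k \<in> I \<Longrightarrow> i \<noteq> k \<Longrightarrow> (\<Sum>v \<in> verts G. w v * F i v * F k v) = 0"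
    and norm: "\<And>i. i \<in> I \<Longrightarrow> (\<Sum>v \<in> verts G. w v * F i v * F i v) \<noteq> 0"
    and eigen: "\<And>i v. i \<in> I \<Longrightarrow> v \<in> verts G \<Longrightarrow>
      laplacian (ends G) (edges G) (F i) v = lam i * w v * F i v"
  shows "(\<Sum>v \<in> verts G. w v) * real (num_spanning_trees G) =
    (\<Prod>v \<in> verts G. w v) * (\<Prod>i \<in> I - {i0}. lam i)"
proof -
  let ?V = "verts G" and ?n = "card (verts G)"
  let ?L = "laplacian (ends G) (edges G)"
  have V: "finite ?V" and sub: "\<And>e. e \<in> edges G \<Longrightarrow> ends G e \<subseteq> ?V"
    using finite_multigraphD[OF G] by blast+
  obtain g where g: "bij_betw g {0..<?n} I" "g 0 = i0"
    using ex_bij_betw_nat_finite_hd[OF I(1,3)] I(2) by metis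
  obtain h where h: "bij_betw h {0..<?n} ?V" using ex_bij_betw_nat_finite[OF V] by blast
  have n0: "0 < ?n" using I by (metis card_gt_0_iff empty_iff)
  have hV: "h j \<in> ?V" if "j < ?n" for j using h that unfolding bij_betw_def by auto
  have gI: "g j \<in> I" if "j < ?n" for j using g(1) that unfolding bij_betw_def by auto
  have ginj: "g i = g j \<longleftrightarrow> i = j" if "i < ?n" "j < ?n" for i j
    using g(1) that unfolding bij_betw_def inj_on_def by auto
  have hinj: "h i = h j \<longleftrightarrow> i = j" if "i < ?n" "j < ?n" for i j
    using h that unfolding bij_betw_def inj_on_def by auto
  have sumV: "(\<Sum>j<?n. f (h j)) = (\<Sum>v\<in>?V. f v)" for f :: "'v \<Rightarrow> real"
    using sum.reindex_bij_betw[OF h, of f] by (simp add: atLeast0LessThan)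
  define W where "W = (\<Sum>v\<in>?V. w v)"
  define gram where "gram i = (\<Sum>v\<in>?V. w v * F i v * F i v)" for i
  define L where "L i j = ?L (indicator {h j}) (h i)" for i j
  have Lsum: "(\<Sum>j<?n. L i j * f (h j)) = ?L f (h i)" for i f
    unfolding L_def sumV[of "\<lambda>v. ?L (indicator {v}) (h i) * f v"]
    by (rule laplacian_indicator_sum[OF V sub])
  have Lone: "(\<Sum>j<?n. L i j * 1) = 0" for i
    unfolding Lsum[of i "\<lambda>_. 1"] by (rule laplacian_const[OF _ sub]) auto

  \<comment> \<open>Adding the weights to a single row of the Laplacian makes it regular.\<close>
  define M where "M i j = (if i = 0 then L i j + 1 * w (h j) else L i j)" for i j
  let ?M = "mat ?n ?n (\<lambda>(i, j). M i j)"
  let ?D = "\<lambda>j. if (0 :: nat) = j then 1 else 0 :: real"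
  let ?row = "\<lambda>r. Determinant.det (mat ?n ?n (\<lambda>(i, j). if i = 0 then r j else L i j))"
  \<comment> \<open>If row 0 sums to zero, the constant vector is in the kernel. Hence only the sum
    of row 0 matters, and the weight row can be replaced by \<open>W\<close> times a unit
    row.\<close>
  have kernel: "?row r = 0" if "(\<Sum>j<?n. r j) = 0" for r
  proof (rule det_zero_if_kernel[of _ "\<lambda>i j. if i = 0 then r j else L i j" "\<lambda>_. 1" 0])
    show "(\<Sum>j<?n. (if i = 0 then r j else L i j) * 1) = 0" for i
      using that Lone[of i] by (cases "i = 0") simp_all
  qed (use n0 in auto)
  have "?row (\<lambda>j. w (h j)) = ?row (\<lambda>j. (w (h j) - W * ?D j) + W * ?D j)"
    by (simp only: diff_add_cancel)
  also have "\<dots> = ?row (\<lambda>j. w (h j) - W * ?D j) + W * ?row ?D"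
    by (rule det_row_linear[OF n0])
  also have "?row (\<lambda>j. w (h j) - W * ?D j) = 0"
  proof (rule kernel)
    have "(\<Sum>j<?n. W * ?D j) = W" using n0 by (simp add: sum_distrib_left[symmetric])
    then show "(\<Sum>j<?n. w (h j) - W * ?D j) = 0"
      using sumV[of w] by (simp only: sum_subtractf W_def)
  qed
  also have "?row ?D = rooted_det ?n h (ends G) (edges G) {h 0}"
  proof (intro arg_cong[of _ _ Determinant.det] cong_mat refl, unfold prod.case)
    fix i j assume "i < ?n" "j < ?n"
    then show "(if i = 0 then ?D j else L i j) = rooted_entry h (ends G) (edges G) {h 0} i j"
      using hinj[of i 0] n0 by (auto simp: rooted_entry_def L_def)
  qed
  also have "\<dots> = real (num_spanning_trees G)"
    by (rule matrix_tree[OF G h hV[OF n0]])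
  finally have row_w: "?row (\<lambda>j. w (h j)) = W * real (num_spanning_trees G)" by simp
  have "Determinant.det ?M = ?row (\<lambda>j. L 0 j + 1 * w (h j))"
    unfolding M_def by (intro arg_cong[of _ _ Determinant.det] cong_mat) auto
  also have "\<dots> = ?row (\<lambda>j. L 0 j) + 1 * ?row (\<lambda>j. w (h j))" by (rule det_row_linear[OF n0])
  also have "?row (\<lambda>j. L 0 j) = 0" using Lone[of 0] by (intro kernel) simp
  finally have detM: "Determinant.det ?M = W * real (num_spanning_trees G)" using row_w by simp

  let ?E = "mat ?n ?n (\<lambda>(j, i). F (g i) (h j))" and ?Et = "mat ?n ?n (\<lambda>(i, j). F (g i) (h j))"
  let ?W = "mat ?n ?n (\<lambda>(i, j). if i = j then w (h i) else 0)"
  \<comment> \<open>Column 0 belongs to the constant mode: the Laplacian kills it and only the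
    weight row survives. In the other columns the weight row pairs a mode with the constant one and
    gives 0.\<close>
  define N where "N j i = (if i = 0 then if j = 0 then W else 0
    else lam (g i) * w (h j) * F (g i) (h j))" for i j :: nat
  have wF: "(\<Sum>v\<in>?V. w v * F i v) = (if i = i0 then W else 0)" if "i \<in> I" for i
  proof -
    have "(\<Sum>v\<in>?V. w v * F i v) = (\<Sum>v\<in>?V. w v * F i0 v * F i v)" using const by simp
    then show ?thesis using orth[OF I(3) that] const by (auto simp: W_def)
  qed
  have g0: "g i = i0 \<longleftrightarrow> i = 0" if "i < ?n" for i using ginj[OF that n0] g(2) by simp
  have ME: "?M * ?E = mat ?n ?n (\<lambda>(j, i). N j i)"
    unfolding mat_mult_mat
  proof (intro cong_mat refl, unfold prod.case)
    fix j i assume j: "j < ?n" and i: "i < ?n"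
    have "(\<Sum>k<?n. M j k * F (g i) (h k)) =
        (\<Sum>k<?n. L j k * F (g i) (h k)) + (if j = 0 then (\<Sum>k<?n. w (h k) * F (g i) (h k)) else 0)"
      unfolding M_def by (simp add: distrib_right sum.distrib)
    also have "\<dots> = ?L (F (g i)) (h j) + (if j = 0 then (\<Sum>v\<in>?V. w v * F (g i) v) else 0)"
      unfolding Lsum sumV[of "\<lambda>v. w v * F (g i) v"] ..
    also have "\<dots> = N j i"
    proof (cases "i = 0")
      case True
      then have "?L (F (g i)) (h j) = 0"
        using const g(2) by (intro laplacian_const[OF _ sub, where c = 1]) auto
      then show ?thesis using True g(2) wF[OF I(3)] by (simp add: N_def)
    next
      case False
      then show ?thesis
        using eigen[OF gI[OF i] hV[OF j]] wF[OF gI[OF i]] g0[OF i] by (simp add: N_def)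
    qed
    finally show "(\<Sum>k<?n. M j k * F (g i) (h k)) = N j i" .
  qed
  have gr: "(\<Sum>v\<in>?V. w v * F (g i) v * F (g k) v) = (if i = k then gram (g k) else 0)"
    if "i < ?n" "k < ?n" for i k
    using orth[OF gI[OF that(1)] gI[OF that(2)]] ginj[OF that] by (simp add: gram_def)
  have EME: "?Et * (?M * ?E) = mat ?n ?n (\<lambda>(k, i).
      if i = 0 then F (g k) (h 0) * W else if k = i then lam (g i) * gram (g i) else 0)"
    unfolding ME unfolding mat_mult_mat
  proof (intro cong_mat refl, unfold prod.case)
    fix k i assume k: "k < ?n" and i: "i < ?n"
    show "(\<Sum>j<?n. F (g k) (h j) * N j i) = (if i = 0 then F (g k) (h 0) * W
        else if k = i then lam (g i) * gram (g i) else 0)"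
    proof (cases "i = 0")
      case True
      then have "(\<Sum>j<?n. F (g k) (h j) * N j i) = (\<Sum>j<?n. if j = 0 then F (g k) (h 0) * W else 0)"
        by (intro sum.cong) (auto simp: N_def)
      then show ?thesis using True n0 by simp
    next
      case False
      then have "(\<Sum>j<?n. F (g k) (h j) * N j i) =
          (\<Sum>j<?n. lam (g i) * (w (h j) * F (g k) (h j) * F (g i) (h j)))"
        by (intro sum.cong) (auto simp: N_def)
      also have "\<dots> = lam (g i) * (\<Sum>v\<in>?V. w v * F (g k) v * F (g i) v)"
        unfolding sum_distrib_left[symmetric] sumV[of "\<lambda>v. w v * F (g k) v * F (g i) v"] ..
      finally show ?thesis using gr[OF k i] False by simp
    qed
  qed
  have EWE: "?Et * (?W * ?E) = mat ?n ?n (\<lambda>(k, i). if k = i then gram (g i) else 0)"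
    unfolding mat_mult_mat
  proof (intro cong_mat refl, unfold prod.case)
    fix k i assume k: "k < ?n" and i: "i < ?n"
    have "(\<Sum>j<?n. F (g k) (h j) * (\<Sum>l<?n. (if j = l then w (h j) else 0) * F (g i) (h l))) =
        (\<Sum>j<?n. w (h j) * F (g k) (h j) * F (g i) (h j))"
    proof (intro sum.cong refl)
      fix j assume "j \<in> {..<?n}"
      moreover have "(if j = l then w (h j) else 0) * F (g i) (h l) =
          (if j = l then w (h j) * F (g i) (h j) else 0)" for l by simp
      ultimately show "F (g k) (h j) * (\<Sum>l<?n. (if j = l then w (h j) else 0) * F (g i) (h l)) =
          w (h j) * F (g k) (h j) * F (g i) (h j)" by simp
    qed
    also have "\<dots> = (\<Sum>v\<in>?V. w v * F (g k) v * F (g i) v)"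
      by (rule sumV[of "\<lambda>v. w v * F (g k) v * F (g i) v"])
    finally show "(\<Sum>j<?n. F (g k) (h j) * (\<Sum>l<?n. (if j = l then w (h j) else 0) * F (g i) (h l))) =
        (if k = i then gram (g i) else 0)" using gr[OF k i] by simp
  qed
  have split0: "(\<Prod>i\<in>{0..<?n}. f i) = f 0 * (\<Prod>i\<in>{0..<?n} - {0}. f i)" for f :: "nat \<Rightarrow> real"
    using n0 by (intro prod.remove) auto
  have gram0: "gram (g 0) = W" using g(2) const by (simp add: gram_def W_def)
  let ?P = "\<lambda>f. \<Prod>i\<in>{0..<?n} - {0}. f (g i) :: real"
  have "Determinant.det (?Et * (?M * ?E)) = W * ?P (\<lambda>i. lam i * gram i)"
    unfolding EME
    by (subst det_lower_triangular[of ?n])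
       (use const[OF hV[OF n0]] g(2) n0 in \<open>auto simp: prod_list_diag_prod split0\<close>)
  then have d1: "Determinant.det ?Et * (Determinant.det ?M * Determinant.det ?E) =
      W * (?P lam * ?P gram)"
    by (simp only: det_mult3[OF mat_carrier mat_carrier mat_carrier] prod.distrib)
  have "Determinant.det (?Et * (?W * ?E)) = W * ?P gram"
    unfolding EWE
    by (subst det_lower_triangular[of ?n]) (use gram0 in \<open>auto simp: prod_list_diag_prod split0\<close>)
  moreover have "Determinant.det ?W = (\<Prod>v\<in>?V. w v)"
    using prod.reindex_bij_betw[OF h, of w]
    by (subst det_lower_triangular[of ?n]) (auto simp: prod_list_diag_prod)
  ultimately have d2: "Determinant.det ?Et * ((\<Prod>v\<in>?V. w v) * Determinant.det ?E) = W * ?P gram"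
    by (simp only: det_mult3[OF mat_carrier mat_carrier mat_carrier])
  \<comment> \<open>The right-hand side of \<open>d2\<close> is nonzero, so the matrix of modes is
    invertible and its determinants can be cancelled between \<open>d1\<close> and
    \<open>d2\<close>.\<close>
  have "W \<noteq> 0" using norm[OF I(3)] const by (simp add: W_def)
  moreover have "?P gram \<noteq> 0" using norm gI by (auto simp: gram_def)
  ultimately have "Determinant.det ?Et * Determinant.det ?E \<noteq> 0" using d2 by auto
  moreover have "(Determinant.det ?Et * Determinant.det ?E) * Determinant.det ?M =
      (Determinant.det ?Et * Determinant.det ?E) * ((\<Prod>v\<in>?V. w v) * ?P lam)"
    using d1 d2 by (simp add: algebra_simps)
  ultimately have "Determinant.det ?M = (\<Prod>v\<in>?V. w v) * ?P lam" by simp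
  moreover have "?P lam = (\<Prod>i \<in> I - {i0}. lam i)"
  proof -
    have "bij_betw g ({0..<?n} - {0}) (I - {i0})"
      using g n0 I(3) by (intro bij_betw_DiffI) auto
    then show ?thesis by (rule prod.reindex_bij_betw)
  qed
  ultimately show ?thesis using detM by (simp add: W_def)
qed

section \<open>Discrete Fourier analysis on an interval with reflecting ends\<close>

text \<open>The weight of a point in the trapezoidal rule on \<open>[0, 2n]\<close>.\<close>

definition end_weight :: "nat \<Rightarrow> real \<Rightarrow> real" where
  "end_weight n t = (if t = 0 \<or> t = 2 * real n then 1/2 else 1)"

definition cos_mode :: "nat \<Rightarrow> nat \<Rightarrow> real \<Rightarrow> real" where
  "cos_mode n j t = cos (real j * pi * t / (2 * real n))"

definition sin_mode :: "nat \<Rightarrow> nat \<Rightarrow> real \<Rightarrow> real" where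
  "sin_mode n j t = sin (real j * pi * t / (2 * real n))"

lemma end_weight_of_nat: "end_weight n (real u) = (if u = 0 \<or> u = 2*n then 1/2 else 1)"
proof -
  have "real u = 2 * real n \<longleftrightarrow> u = 2*n" by linarith
  then show ?thesis by (simp add: end_weight_def)
qed

lemma sum_end_weight:
  assumes "n \<ge> 1"
  shows "(\<Sum>u\<le>2*n. end_weight n (real u) * f u) = (\<Sum>u<2*n. (f u + f (Suc u)) / 2)"
proof -
  have tel: "(\<Sum>u<N. (f u + f (Suc u)) / 2) = (\<Sum>u\<le>N. f u) - (f 0 + f N) / 2" for N
    by (induction N) (auto simp: field_simps)
  have "end_weight n (real u) * f u = f u - (if u = 0 then f 0 / 2 else 0) - (if u = 2*n then f (2*n) / 2 else 0)"
    for u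
    using assms by (auto simp: end_weight_of_nat)
  then show ?thesis unfolding tel by (simp add: sum_subtractf add_divide_distrib)
qed

text \<open>With \<open>a = m * pi / (2n)\<close>, multiplication by \<open>sin (a/2)\<close>
  telescopes the trapezoidal sum to \<open>cos (a/2) * sin (2n * a) / 2\<close>, which vanishes as
  \<open>2n * a\<close> is a multiple of pi. The bound on \<open>m\<close> keeps \<open>a/2\<close>
  strictly between -pi and pi. The halved ends make this work for odd \<open>m\<close> too.\<close>

lemma sum_end_weight_cos:
  assumes n: "n \<ge> 1" and m: "m \<noteq> 0" "\<bar>m\<bar> < 4 * real n" and int: "m \<in> \<int>"
  shows "(\<Sum>u\<le>2*n. end_weight n (real u) * cos (m * pi * real u / (2 * real n))) = 0"
proof -
  define a where "a = m * pi / (2 * real n)"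
  have tel: "sin (a/2) * (\<Sum>u<N. (cos (a * real u) + cos (a * real (Suc u))) / 2) =
      cos (a/2) * sin (a * real N) / 2" for N
  proof (induction N)
    case (Suc N)
    have "sin (a/2) * (cos (a * real N) + cos (a * real (Suc N))) =
        cos (a/2) * (sin (a * real (Suc N)) - sin (a * real N))"
    proof -
      have "sin y * (cos (x - y) + cos (x + y)) = cos y * (sin (x + y) - sin (x - y))" for x y :: real
        unfolding sin_add sin_diff cos_add cos_diff by (simp add: algebra_simps)
      from this[of "a/2" "a * real N + a/2"] show ?thesis by (simp add: distrib_left add.commute)
    qed
    then show ?case using Suc by (simp add: field_simps)
  qed simp
  have "sin (a/2) \<noteq> 0"
  proof -
    have a: "\<bar>a/2\<bar> < pi" "a/2 \<noteq> 0"
      using n m by (auto simp: a_def abs_mult divide_less_eq)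
    then have "0 < sin \<bar>a/2\<bar>" by (intro sin_gt_zero) auto
    then show ?thesis by (auto simp: abs_if split: if_splits)
  qed
  moreover have "sin (a * real (2*n)) = 0"
    using n int by (auto simp: a_def sin_zero_iff_int2 elim!: Ints_cases)
  ultimately have "(\<Sum>u<2*n. (cos (a * real u) + cos (a * real (Suc u))) / 2) = 0"
    using tel[of "2*n"] by simp
  then show ?thesis
    unfolding sum_end_weight[OF n, of "\<lambda>u. cos (m * pi * real u / (2 * real n))"]
    by (simp add: a_def field_simps)
qed

text \<open>Product-to-sum leaves the frequencies \<open>j - k\<close> and \<open>j + k\<close>;
  since \<open>j \<noteq> k\<close>, neither is 0 and \<open>j + k\<close> stays below
  \<open>4n\<close>.\<close>

lemma cos_mode_orthogonal:
  assumes n: "n \<ge> 1" and "j \<le> 2*n" "k \<le> 2*n" "j \<noteq> k"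
  shows "(\<Sum>u\<le>2*n. end_weight n (real u) * (cos_mode n j (real u) * cos_mode n k (real u))) = 0"
proof -
  have e: "end_weight n (real u) * (cos_mode n j (real u) * cos_mode n k (real u)) =
     (end_weight n (real u) * cos ((real j - real k) * pi * real u / (2 * real n)) +
      end_weight n (real u) * cos ((real j + real k) * pi * real u / (2 * real n))) / 2" for u
    unfolding cos_mode_def cos_times_cos
    by (simp add: algebra_simps add_divide_distrib diff_divide_distrib)
  have "(\<Sum>u\<le>2*n. end_weight n (real u) * cos ((real j - real k) * pi * real u / (2 * real n))) = 0"
    using assms by (intro sum_end_weight_cos) auto
  moreover have
    "(\<Sum>u\<le>2*n. end_weight n (real u) * cos ((real j + real k) * pi * real u / (2 * real n))) = 0"
    using assms by (intro sum_end_weight_cos) auto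
  ultimately show ?thesis unfolding e sum_divide_distrib[symmetric] sum.distrib by simp
qed

lemma sin_mode_orthogonal:
  assumes n: "n \<ge> 1" and "j \<le> 2*n" "k \<le> 2*n" "j \<noteq> k"
  shows "(\<Sum>u\<le>2*n. end_weight n (real u) * (sin_mode n j (real u) * sin_mode n k (real u))) = 0"
proof -
  have e: "end_weight n (real u) * (sin_mode n j (real u) * sin_mode n k (real u)) =
     (end_weight n (real u) * cos ((real j - real k) * pi * real u / (2 * real n)) -
      end_weight n (real u) * cos ((real j + real k) * pi * real u / (2 * real n))) / 2" for u
    unfolding sin_mode_def sin_times_sin
    by (simp add: algebra_simps add_divide_distrib diff_divide_distrib)
  have "(\<Sum>u\<le>2*n. end_weight n (real u) * cos ((real j - real k) * pi * real u / (2 * real n))) = 0"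
    using assms by (intro sum_end_weight_cos) auto
  moreover have
    "(\<Sum>u\<le>2*n. end_weight n (real u) * cos ((real j + real k) * pi * real u / (2 * real n))) = 0"
    using assms by (intro sum_end_weight_cos) auto
  ultimately show ?thesis unfolding e sum_divide_distrib[symmetric] sum_subtractf by simp
qed

lemma end_weight_pos: "end_weight n t > 0"
  by (simp add: end_weight_def)

text \<open>The term at \<open>u = 0\<close> is already 1/2. Positivity suffices, as the norms
  cancel in the end.\<close>

lemma cos_mode_norm_pos:
  "(\<Sum>u\<le>2*n. end_weight n (real u) * (cos_mode n j (real u) * cos_mode n j (real u))) > 0"
  using end_weight_pos[of n]
  by (intro sum_pos2[of _ 0]) (auto simp: cos_mode_def less_imp_le intro!: mult_nonneg_nonneg)

lemma sin_mode_norm_pos: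
  assumes "j \<in> {1..2*n - 1}"
  shows "(\<Sum>u\<le>2*n. end_weight n (real u) * (sin_mode n j (real u) * sin_mode n j (real u))) > 0"
proof (rule sum_pos2[of _ 1])
  have "sin_mode n j (real 1) > 0" unfolding sin_mode_def
  proof (rule sin_gt_zero)
    have "real j < 2 * real n" "0 < real j" using assms by auto
    then show "0 < real j * pi * real 1 / (2 * real n)" "real j * pi * real 1 / (2 * real n) < pi"
      by (simp_all add: divide_less_eq)
  qed
  then show "0 < end_weight n (real 1) * (sin_mode n j (real 1) * sin_mode n j (real 1))"
    using end_weight_pos by simp
qed (use assms end_weight_pos[of n] in \<open>auto simp: less_imp_le intro!: mult_nonneg_nonneg\<close>)

lemma mode_reflect_aux:
  assumes "n \<ge> 1" "j \<le> 2*n"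
  shows "real (2*n - j) * pi * real u / (2 * real n) = real u * pi - real j * pi * real u / (2 * real n)"
  using assms by (simp add: of_nat_diff field_simps)

text \<open>Reflecting both frequencies of a product of modes yields (-1)^(u + v), a constant sign
  on each parity class; the extra minus signs of two sine factors cancel. This is why half of the
  modes suffice.\<close>

lemma cos_mode_reflect:
  "n \<ge> 1 \<Longrightarrow> j \<le> 2*n \<Longrightarrow> cos_mode n (2*n - j) (real u) = (-1)^u * cos_mode n j (real u)"
  unfolding cos_mode_def mode_reflect_aux by (simp add: cos_diff)

lemma sin_mode_reflect:
  "n \<ge> 1 \<Longrightarrow> j \<le> 2*n \<Longrightarrow> sin_mode n (2*n - j) (real u) = - ((-1)^u * sin_mode n j (real u))"
  unfolding sin_mode_def mode_reflect_aux by (simp add: sin_diff)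

section \<open>Parity classes of points and half squares of frequencies\<close>

definition parity_pairs :: "bool \<Rightarrow> nat set \<Rightarrow> (nat \<times> nat) set" where
  "parity_pairs ev S = {(u, v) \<in> S \<times> S. even (u + v) = ev}"

lemma mem_parity_pairs: "(u, v) \<in> parity_pairs ev S \<longleftrightarrow> u \<in> S \<and> v \<in> S \<and> even (u + v) = ev"
  unfolding parity_pairs_def by auto

lemma finite_parity_pairs: "finite S \<Longrightarrow> finite (parity_pairs ev S)"
  unfolding parity_pairs_def by (rule finite_subset[of _ "S \<times> S"]) auto

text \<open>The indicator of a parity class is (1 + eps (-1)^u (-1)^v) / 2, a sum of two products,
  so sums of product functions still factor.\<close>

lemma sum_parity_pairs:
  fixes f g :: "nat \<Rightarrow> real"
  assumes "finite S"
  shows "(\<Sum>(u, v) \<in> parity_pairs ev S. f u * g v) =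
    ((\<Sum>u\<in>S. f u) * (\<Sum>v\<in>S. g v) +
     (if ev then 1 else -1) * (\<Sum>u\<in>S. (-1)^u * f u) * (\<Sum>v\<in>S. (-1)^v * g v)) / 2"
proof -
  let ?\<epsilon> = "if ev then 1 else -1 :: real"
  have "(\<Sum>(u, v) \<in> parity_pairs ev S. f u * g v) =
      (\<Sum>p \<in> S \<times> S. if even (fst p + snd p) = ev then f (fst p) * g (snd p) else 0)"
    using assms unfolding parity_pairs_def by (intro sum.mono_neutral_cong_left) auto
  also have "\<dots> = (\<Sum>p \<in> S \<times> S. (f (fst p) * g (snd p) +
      ?\<epsilon> * (((-1)^fst p * f (fst p)) * ((-1)^snd p * g (snd p)))) / 2)"
    by (intro sum.cong refl) (auto simp: minus_one_power_iff)
  also have "\<dots> = ((\<Sum>p \<in> S \<times> S. f (fst p) * g (snd p)) +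
      ?\<epsilon> * (\<Sum>p \<in> S \<times> S. ((-1)^fst p * f (fst p)) * ((-1)^snd p * g (snd p)))) / 2"
    by (simp only: sum_divide_distrib[symmetric] sum.distrib sum_distrib_left[symmetric])
  finally show ?thesis
    by (simp only: sum_product sum.cartesian_product split_def mult.assoc)
qed

text \<open>Representatives of the pairs of modes modulo \<open>(j, k) \<mapsto> (2n - j, 2n - k)\<close>: on a fixed parity
  class, the modes in such a pair agree up to sign.  The fixed point \<open>(n, n)\<close> vanishes on the odd
  class.\<close>

definition half_square :: "nat \<Rightarrow> bool \<Rightarrow> nat set \<Rightarrow> (nat \<times> nat) set" where
  "half_square n ev S = {(j, k) \<in> S \<times> S. j < n \<or> j = n \<and> (k < n \<or> ev \<and> k = n)}"

lemma finite_half_square: "finite S \<Longrightarrow> finite (half_square n ev S)"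
  by (rule finite_subset[of _ "S \<times> S"]) (auto simp: half_square_def)

text \<open>\<open>a = 0\<close> serves the cosine modes and the whole diamond, \<open>a = 1\<close>
  the sine modes and the points off the seam. Agreement with \<open>card_parity_pairs\<close> shows
  that there are as many modes as vertices.\<close>

lemma card_half_square:
  assumes "a \<le> n"
  shows "2 * real (card (half_square n ev {a..2*n - a})) =
    (2 * real (n - a) + 1)\<^sup>2 + (if ev then 1 else -1)"
proof -
  define T where "T = (if ev then {a..n} else {a..<n})"
  have "half_square n ev {a..2*n - a} = {a..<n} \<times> {a..2*n - a} \<union> {n} \<times> T"
    using assms unfolding half_square_def T_def by auto
  moreover have "card ({a..<n} \<times> {a..2*n - a} \<union> {n} \<times> T) =
      card ({a..<n} \<times> {a..2*n - a}) + card ({n} \<times> T)"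
    unfolding T_def by (intro card_Un_disjoint) auto
  moreover obtain m where "n = a + m" using assms by (metis le_add_diff_inverse)
  ultimately have "card (half_square n ev {a..2*n - a}) =
      m * (2*m + 1) + (m + (if ev then 1 else 0))" "n - a = m"
    by (auto simp: card_cartesian_product T_def)
  then show ?thesis by (simp add: power2_eq_square algebra_simps)
qed

lemma card_parity_pairs:
  assumes "a \<le> n"
  shows "2 * real (card (parity_pairs ev {a..2*n - a})) =
    (2 * real (n - a) + 1)\<^sup>2 + (if ev then 1 else -1)"
proof -
  \<comment> \<open>The interval has odd length, so the alternating sum collapses to a sign, whose
    square is 1.\<close>
  have alt: "(\<Sum>u\<in>{a..a + 2*m}. (-1)^u) = ((-1)^a :: real)" for m
    by (induction m) auto
  have S: "{a..2*n - a} = {a..a + 2*(n - a)}" using assms by auto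
  have "real (card (parity_pairs ev {a..2*n - a})) =
      (\<Sum>(u, v) \<in> parity_pairs ev {a..2*n - a}. 1 * 1)" by (simp add: split_def)
  also have "2 * \<dots> = (2 * real (n - a) + 1)\<^sup>2 + (if ev then 1 else -1)"
    unfolding S sum_parity_pairs[of "{a..a + 2*(n - a)}" "\<lambda>_. 1" "\<lambda>_. 1" ev, OF finite_atLeastAtMost]
    by (simp add: alt power2_eq_square add.commute)
  finally show ?thesis .
qed

text \<open>Shared by both families: \<open>C\<close> is the Gram matrix in one variable and
  \<open>x\<close> the inner product on a parity class. The second summand of \<open>x\<close>
  compares \<open>(j, k)\<close> with the reflection of \<open>(j', k')\<close>; inside the half
  square they meet only at \<open>(n, n)\<close>, where both summands agree.\<close>

lemma half_square_gram:
  fixes C :: "nat \<Rightarrow> nat \<Rightarrow> real" and a n :: nat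
  defines "S \<equiv> {a..2*n - a}"
  assumes C: "\<And>j k. j \<in> S \<Longrightarrow> k \<in> S \<Longrightarrow> j \<noteq> k \<Longrightarrow> C j k = 0" "\<And>j. j \<in> S \<Longrightarrow> C j j > 0"
    and jk: "(j, k) \<in> half_square n ev S" and jk': "(j', k') \<in> half_square n ev S"
  defines "x \<equiv> (C j j' * C k k' + (if ev then 1 else -1) * C j (2*n - j') * C k (2*n - k')) / 2"
  shows "(j, k) \<noteq> (j', k') \<Longrightarrow> x = 0" "(j, k) = (j', k') \<Longrightarrow> x > 0"
proof -
  have m: "j \<in> S" "k \<in> S" "j' \<in> S" "k' \<in> S" using jk jk' by (auto simp: half_square_def)
  have r: "2*n - j' \<in> S" "2*n - k' \<in> S" using m unfolding S_def by auto
  have cross: "j = n \<and> k = n \<and> j' = n \<and> k' = n \<and> ev" if "j = 2*n - j'" "k = 2*n - k'"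
    using jk jk' that m unfolding half_square_def S_def by auto
  have z: "C j (2*n - j') * C k (2*n - k') = 0" if "j \<noteq> n \<or> k \<noteq> n \<or> j' \<noteq> n \<or> k' \<noteq> n \<or> \<not> ev"
  proof -
    have "j \<noteq> 2*n - j' \<or> k \<noteq> 2*n - k'" using cross that by blast
    then show ?thesis using C(1)[OF m(1) r(1)] C(1)[OF m(2) r(2)] by auto
  qed
  show "x = 0" if "(j, k) \<noteq> (j', k')"
  proof -
    have "C j j' * C k k' = 0" using C(1)[OF m(1,3)] C(1)[OF m(2,4)] that by auto
    moreover have "C j (2*n - j') * C k (2*n - k') = 0" using that by (intro z) auto
    ultimately show ?thesis unfolding x_def by (auto simp: mult.assoc)
  qed
  show "x > 0" if "(j, k) = (j', k')"
  proof -
    have p: "C j j * C k k > 0" using C(2) m by simp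
    show ?thesis
    proof (cases "j = n \<and> k = n \<and> ev")
      case True
      then have eq: "j = n" "k = n" "j' = n" "k' = n" "2*n - n = n" using that by auto
      have "x = C n n * C n n" using True unfolding x_def eq by simp
      then show ?thesis using p unfolding eq by simp
    next
      case False
      then have "C j (2*n - j') * C k (2*n - k') = 0" by (intro z) auto
      then show ?thesis using p that unfolding x_def by (auto simp: mult.assoc)
    qed
  qed
qed

text \<open>The reflection swaps the two halves of \<open>S \<times> S\<close> and fixes
  \<open>(n, n)\<close>, so the full product is \<open>f (n, n)\<close> times a square.\<close>

lemma prod_half_square:
  fixes f :: "nat \<times> nat \<Rightarrow> real"
  assumes a: "a \<le> n"
  defines "S \<equiv> {a..2*n - a}"
  assumes sym: "\<And>j k. j \<in> S \<Longrightarrow> k \<in> S \<Longrightarrow> f (2*n - j, 2*n - k) = f (j, k)"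
  shows "(\<Prod>p \<in> half_square n True S. f p) = f (n, n) * (\<Prod>p \<in> half_square n False S. f p)"
    "(\<Prod>p \<in> S \<times> S. f p) = f (n, n) * (\<Prod>p \<in> half_square n False S. f p)\<^sup>2"
proof -
  let ?H = "half_square n False S" and ?T = "half_square n True S"
  let ?R = "{(j, k) \<in> S \<times> S. n < j \<or> j = n \<and> n < k}"
  let ?r = "\<lambda>(j, k). (2*n - j, 2*n - k)"
  have fin: "finite (S \<times> S)" unfolding S_def by simp
  have finH: "finite ?H" "finite ?T" "finite ?R"
    by (rule finite_subset[OF _ fin], force simp: half_square_def)+
  have "?T = insert (n, n) ?H" "(n, n) \<notin> ?H"
    using a unfolding half_square_def S_def by auto
  then show one: "(\<Prod>p \<in> ?T. f p) = f (n, n) * (\<Prod>p \<in> ?H. f p)" using finH by simp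
  have bij: "bij_betw ?r ?H ?R"
    by (rule bij_betw_byWitness[of _ ?r]) (auto simp: half_square_def S_def)
  have "S \<times> S = ?T \<union> ?R" "?T \<inter> ?R = {}" unfolding half_square_def by auto
  then have "(\<Prod>p \<in> S \<times> S. f p) = (\<Prod>p \<in> ?T. f p) * (\<Prod>p \<in> ?R. f p)"
    using prod.union_disjoint[OF finH(2,3), of f] by metis
  also have "(\<Prod>p \<in> ?R. f p) = (\<Prod>p \<in> ?H. f (?r p))"
    by (rule prod.reindex_bij_betw[OF bij, symmetric])
  also have "\<dots> = (\<Prod>p \<in> ?H. f p)"
    using sym by (intro prod.cong refl) (auto simp: half_square_def)
  finally show "(\<Prod>p \<in> S \<times> S. f p) = f (n, n) * (\<Prod>p \<in> ?H. f p)\<^sup>2"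
    unfolding one by (simp add: power2_eq_square)
qed

section \<open>Pillowcases\<close>

text \<open>The equivalence class of \<open>x\<close> under the gluing relation, as an explicit
  product that no longer mentions the graph.\<close>

definition pillow_class :: "'v set \<Rightarrow> 'v \<times> bool \<Rightarrow> ('v \<times> bool) set" where
  "pillow_class B x = {fst x} \<times> {c. c = snd x \<or> fst x \<in> B}"

lemma pillow_class_eq_iff:
  "pillow_class B (p, b) = pillow_class B (q, c) \<longleftrightarrow> p = q \<and> (b = c \<or> p \<in> B)"
  unfolding pillow_class_def by (auto simp: times_eq_iff)

lemma pillow_class_Image:
  assumes "p \<in> verts G"
  shows "{((u, b), (v, c)) | u v b c. u \<in> verts G \<and> u = v \<and> (b = c \<or> u \<in> B)} `` {(p, b)} =
    pillow_class B (p, b)"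
  using assms unfolding pillow_class_def by auto

lemma verts_pillowcase: "verts (pillowcase G B) = pillow_class B ` (verts G \<times> UNIV)"
proof -
  have "verts (pillowcase G B) = (\<lambda>x. {((u, b), (v, c)) | u v b c.
      u \<in> verts G \<and> u = v \<and> (b = c \<or> u \<in> B)} `` {x}) ` (verts G \<times> UNIV)"
    unfolding pillowcase_def identify_def two_copies_def quotient_def by auto
  also have "\<dots> = pillow_class B ` (verts G \<times> UNIV)"
  proof (intro image_cong refl)
    fix x assume "x \<in> verts G \<times> (UNIV :: bool set)"
    then show "{((u, b), (v, c)) | u v b c. u \<in> verts G \<and> u = v \<and> (b = c \<or> u \<in> B)} `` {x} =
        pillow_class B x"
      using pillow_class_Image[of "fst x" G B "snd x"] by (simp add: mem_Times_iff)
  qed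
  finally show ?thesis .
qed

lemma edges_pillowcase: "edges (pillowcase G B) = edges G \<times> UNIV"
  unfolding pillowcase_def identify_def two_copies_def by simp

lemma ends_pillowcase:
  assumes "ends G e \<subseteq> verts G"
  shows "ends (pillowcase G B) (e, c) = (\<lambda>p. pillow_class B (p, c)) ` ends G e"
proof -
  have "ends (pillowcase G B) (e, c) = (\<lambda>p. {((u, b), (v, c)) | u v b c.
      u \<in> verts G \<and> u = v \<and> (b = c \<or> u \<in> B)} `` {(p, c)}) ` ends G e"
    unfolding pillowcase_def identify_def two_copies_def by (simp add: image_image)
  also have "\<dots> = (\<lambda>p. pillow_class B (p, c)) ` ends G e"
    using assms by (intro image_cong refl pillow_class_Image) auto
  finally show ?thesis .
qed

lemma finite_multigraph_pillowcase:
  assumes G: "finite_multigraph G"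
  shows "finite_multigraph (pillowcase G B)"
  unfolding finite_multigraph_def verts_pillowcase edges_pillowcase
proof (intro conjI ballI)
  show "finite (pillow_class B ` (verts G \<times> UNIV))" "finite (edges G \<times> (UNIV :: bool set))"
    using finite_multigraphD[OF G] by simp_all
  fix x assume "x \<in> edges G \<times> (UNIV :: bool set)"
  then obtain e c where x: "x = (e, c)" "e \<in> edges G" by auto
  obtain p q where pq: "p \<in> verts G" "q \<in> verts G" "ends G e = {p, q}"
    using G x(2) unfolding finite_multigraph_def by blast
  have "ends (pillowcase G B) x = {pillow_class B (p, c), pillow_class B (q, c)}"
    unfolding x(1) using ends_pillowcase[OF finite_multigraphD(3)[OF G x(2)]] pq(3) by simp
  then show "\<exists>a \<in> pillow_class B ` (verts G \<times> UNIV). \<exists>b \<in> pillow_class B ` (verts G \<times> UNIV).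
      ends (pillowcase G B) x = {a, b}"
    using pq(1,2) by (intro bexI[of _ "pillow_class B (p, c)"] bexI[of _ "pillow_class B (q, c)"]) auto
qed

text \<open>Vertices of the pillowcase are sets of vertices of the two copies, so each is its own
  fibre; summing over classes and then over members is summing over both sheets.\<close>

lemma pillow_class_fiber:
  assumes "C \<in> verts (pillowcase G B)"
  shows "{x \<in> verts G \<times> UNIV. pillow_class B x = C} = C"
proof -
  obtain p b where p: "p \<in> verts G" "C = pillow_class B (p, b)"
    using assms unfolding verts_pillowcase by auto
  have "pillow_class B x = C \<longleftrightarrow> x \<in> C" for x
  proof (cases x)
    case (Pair q c)
    have "(q, c) \<in> C \<longleftrightarrow> q = p \<and> (c = b \<or> p \<in> B)" unfolding p(2) pillow_class_def by auto
    moreover have "pillow_class B (q, c) = C \<longleftrightarrow> q = p \<and> (c = b \<or> p \<in> B)"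
      unfolding p(2) pillow_class_eq_iff by auto
    ultimately show ?thesis unfolding Pair by (simp only:)
  qed
  moreover have "x \<in> verts G \<times> UNIV" if "x \<in> C" for x
    using that p(1) unfolding p(2) pillow_class_def by auto
  ultimately show ?thesis by auto
qed

lemma pillow_class_member:
  assumes "C \<in> verts (pillowcase G B)" "x \<in> C"
  shows "fst x \<in> verts G" "pillow_class B x = C"
proof -
  have "x \<in> {x \<in> verts G \<times> UNIV. pillow_class B x = C}"
    unfolding pillow_class_fiber[OF assms(1)] by (rule assms(2))
  then show "fst x \<in> verts G" "pillow_class B x = C" by auto
qed

lemma sum_pillow_classes:
  assumes "finite (verts G)"
  shows "(\<Sum>C \<in> verts (pillowcase G B). \<Sum>x \<in> C. f x) = (\<Sum>p \<in> verts G. \<Sum>b \<in> UNIV. f (p, b))"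
proof -
  have "(\<Sum>C \<in> verts (pillowcase G B). \<Sum>x \<in> C. f x) =
      (\<Sum>C \<in> verts (pillowcase G B). \<Sum>x \<in> {x \<in> verts G \<times> UNIV. pillow_class B x = C}. f x)"
    by (intro sum.cong refl) (simp_all add: pillow_class_fiber)
  also have "\<dots> = (\<Sum>x \<in> verts G \<times> UNIV. f x)"
    using assms by (intro sum.group) (auto simp: verts_pillowcase)
  finally show ?thesis by (simp add: sum.cartesian_product)
qed

lemma bij_betw_pillow_class:
  "bij_betw (pillow_class B) (verts G \<times> {False} \<union> (verts G - B) \<times> {True}) (verts (pillowcase G B))"
  unfolding bij_betw_def
proof
  show "inj_on (pillow_class B) (verts G \<times> {False} \<union> (verts G - B) \<times> {True})"
    by (intro inj_onI) (auto simp: pillow_class_eq_iff)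
  show "pillow_class B ` (verts G \<times> {False} \<union> (verts G - B) \<times> {True}) = verts (pillowcase G B)"
    unfolding verts_pillowcase
  proof (intro equalityI subsetI)
    fix C assume "C \<in> pillow_class B ` (verts G \<times> UNIV)"
    then obtain p b where p: "p \<in> verts G" "C = pillow_class B (p, b)" by auto
    show "C \<in> pillow_class B ` (verts G \<times> {False} \<union> (verts G - B) \<times> {True})"
    proof (cases "b \<and> p \<notin> B")
      case True
      then show ?thesis using p by auto
    next
      case False
      then have "C = pillow_class B (p, False)" using p(2) by (auto simp: pillow_class_eq_iff)
      then show ?thesis using p(1) by auto
    qed
  qed auto
qed

lemma card_verts_pillowcase:
  assumes "finite (verts G)"
  shows "card (verts (pillowcase G B)) = card (verts G) + card (verts G - B)"
proof -
  have "card (verts (pillowcase G B)) = card (verts G \<times> {False} \<union> (verts G - B) \<times> {True})"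
    using bij_betw_same_card[OF bij_betw_pillow_class] by metis
  also have "\<dots> = card (verts G \<times> {False}) + card ((verts G - B) \<times> {True})"
    using assms by (intro card_Un_disjoint) auto
  finally show ?thesis by (simp add: card_cartesian_product)
qed

lemma prod_pillow_classes:
  fixes G :: "('v, 'e) multigraph" and f :: "('v \<times> bool) set \<Rightarrow> 'c :: comm_monoid_mult"
  assumes "finite (verts G)"
  shows "(\<Prod>C \<in> verts (pillowcase G B). f C) =
    (\<Prod>p \<in> verts G. f (pillow_class B (p, False))) * (\<Prod>p \<in> verts G - B. f (pillow_class B (p, True)))"
proof -
  have r: "(\<Prod>x \<in> S \<times> {b}. g x) = (\<Prod>p \<in> S. g (p, b))" for S and b :: bool and g :: "'v \<times> bool \<Rightarrow> 'c"
    by (rule prod.reindex_cong[of "\<lambda>p. (p, b)"]) (auto intro: inj_onI)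
  have "(\<Prod>C \<in> verts (pillowcase G B). f C) =
      (\<Prod>x \<in> verts G \<times> {False} \<union> (verts G - B) \<times> {True}. f (pillow_class B x))"
    by (rule prod.reindex_bij_betw[OF bij_betw_pillow_class, symmetric])
  also have "\<dots> = (\<Prod>x \<in> verts G \<times> {False}. f (pillow_class B x)) *
      (\<Prod>x \<in> (verts G - B) \<times> {True}. f (pillow_class B x))"
    using assms by (intro prod.union_disjoint) auto
  finally show ?thesis unfolding r .
qed

text \<open>Gluing merges no edges, so the edges at a class are those at its members, sheet by
  sheet, and the Laplacian adds up over the members.\<close>

lemma laplacian_pillowcase:
  assumes G: "finite_multigraph G" and p: "p \<in> verts G"
    and F: "\<And>q c. q \<in> verts G \<Longrightarrow> F (pillow_class B (q, c)) = f q c"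
  shows "laplacian (ends (pillowcase G B)) (edges (pillowcase G B)) F (pillow_class B (p, b)) =
    (\<Sum>x \<in> pillow_class B (p, b). laplacian (ends G) (edges G) (\<lambda>q. f q (snd x)) (fst x))"
proof -
  let ?K = "{c. c = b \<or> p \<in> B}" and ?E = "{e \<in> edges G. p \<in> ends G e}"
  have K: "pillow_class B (p, b) = {p} \<times> ?K" by (simp add: pillow_class_def)
  have sub: "\<And>e. e \<in> edges G \<Longrightarrow> ends G e \<subseteq> verts G" using finite_multigraphD(3)[OF G] .
  \<comment> \<open>On the seam both sheets represent the same class, so well-definedness of
    \<open>F\<close> forces \<open>f\<close> to agree there.\<close>
  have fc: "f p b = f p c" if "c \<in> ?K" for c
    using F[OF p, of b] F[OF p, of c] pillow_class_eq_iff[of B p b p c] that by auto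
  have "{x \<in> edges G \<times> UNIV. pillow_class B (p, b) \<in> ends (pillowcase G B) x} = ?E \<times> ?K"
  proof (intro Set.set_eqI)
    fix x :: "'b \<times> bool"
    show "x \<in> {x \<in> edges G \<times> UNIV. pillow_class B (p, b) \<in> ends (pillowcase G B) x} \<longleftrightarrow> x \<in> ?E \<times> ?K"
      using ends_pillowcase[OF sub, of "fst x" B "snd x"]
      by (cases x) (auto simp: pillow_class_eq_iff image_iff)
  qed
  then have "laplacian (ends (pillowcase G B)) (edges (pillowcase G B)) F (pillow_class B (p, b)) =
      (\<Sum>x \<in> ?E \<times> ?K. \<Sum>C \<in> ends (pillowcase G B) x. F (pillow_class B (p, b)) - F C)"
    unfolding laplacian_def edges_pillowcase by (simp only:)
  also have "\<dots> = (\<Sum>x \<in> ?E \<times> ?K. \<Sum>q \<in> ends G (fst x). f p (snd x) - f q (snd x))"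
  proof (intro sum.cong refl)
    fix x assume x: "x \<in> ?E \<times> ?K"
    then obtain e c where ec: "x = (e, c)" "e \<in> edges G" "c \<in> ?K" by auto
    \<comment> \<open>Gluing identifies nothing within one sheet, so an edge keeps its number of
      ends.\<close>
    have inj: "inj_on (\<lambda>q. pillow_class B (q, c)) (ends G e)"
      by (intro inj_onI) (simp add: pillow_class_eq_iff)
    have "(\<Sum>C \<in> ends (pillowcase G B) x. F (pillow_class B (p, b)) - F C) =
        (\<Sum>q \<in> ends G e. F (pillow_class B (p, b)) - F (pillow_class B (q, c)))"
      unfolding ec(1) ends_pillowcase[OF sub[OF ec(2)]] by (subst sum.reindex[OF inj]) simp
    also have "\<dots> = (\<Sum>q \<in> ends G e. f p c - f q c)"
      using F[OF p, of b] F[of _ c] sub[OF ec(2)] fc[OF ec(3)] by (intro sum.cong refl) auto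
    finally show "(\<Sum>C \<in> ends (pillowcase G B) x. F (pillow_class B (p, b)) - F C) =
      (\<Sum>q \<in> ends G (fst x). f p (snd x) - f q (snd x))" using ec(1) by simp
  qed
  also have "\<dots> = (\<Sum>e \<in> ?E. \<Sum>c \<in> ?K. \<Sum>q \<in> ends G e. f p c - f q c)"
    by (subst sum.cartesian_product) (simp only: split_def)
  also have "\<dots> = (\<Sum>c \<in> ?K. laplacian (ends G) (edges G) (\<lambda>q. f q c) p)"
    unfolding laplacian_def by (rule sum.swap)
  also have "\<dots> = (\<Sum>x \<in> {p} \<times> ?K. laplacian (ends G) (edges G) (\<lambda>q. f q (snd x)) (fst x))"
    by (rule sum.reindex_cong[of snd]) (auto intro!: inj_onI)
  finally show ?thesis unfolding K .
qed

section \<open>Aztec diamonds in rotated coordinates\<close>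

definition ucoord :: "nat \<Rightarrow> real \<times> real \<Rightarrow> real" where
  "ucoord n p = fst p + snd p + real n"

definition vcoord :: "nat \<Rightarrow> real \<times> real \<Rightarrow> real" where
  "vcoord n p = fst p - snd p + real n"

definition lattice_pt :: "nat \<Rightarrow> nat \<times> nat \<Rightarrow> real \<times> real" where
  "lattice_pt n = (\<lambda>(u, v). ((real u + real v) / 2 - real n, (real u - real v) / 2))"

lemma ucoord_lattice_pt [simp]: "ucoord n (lattice_pt n (u, v)) = real u"
  and vcoord_lattice_pt [simp]: "vcoord n (lattice_pt n (u, v)) = real v"
  by (simp_all add: ucoord_def vcoord_def lattice_pt_def field_simps)

lemma lattice_pt_eqI: "ucoord n p = real u \<Longrightarrow> vcoord n p = real v \<Longrightarrow> p = lattice_pt n (u, v)"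
  by (auto simp: ucoord_def vcoord_def lattice_pt_def prod_eq_iff field_simps)

lemma inj_lattice_pt: "inj (lattice_pt n)"
  by (rule injI) (auto dest: arg_cong[of _ _ "ucoord n"] arg_cong[of _ _ "vcoord n"]
    simp: split_paired_all)

definition diamond :: "nat \<Rightarrow> bool \<Rightarrow> (real \<times> real, (real \<times> real) set) multigraph" where
  "diamond n ev = \<lparr>verts = lattice_pt n ` parity_pairs ev {0..2*n},
     edges = {{p, q} | p q. p \<in> lattice_pt n ` parity_pairs ev {0..2*n} \<and>
       q \<in> lattice_pt n ` parity_pairs ev {0..2*n} \<and> dist p q = 1}, ends = (\<lambda>e. e)\<rparr>"

lemma l1_ball_iff:
  "p \<in> l1_ball n \<longleftrightarrow> 0 \<le> ucoord n p \<and> ucoord n p \<le> 2 * real n \<and> 0 \<le> vcoord n p \<and> vcoord n p \<le> 2 * real n"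
  unfolding l1_ball_def ucoord_def vcoord_def by (cases p) (auto simp: abs_if)

lemma l1_ball_lattice_pt:
  assumes "p \<in> l1_ball n" "ucoord n p = of_int a" "vcoord n p = of_int b"
  shows "p \<in> lattice_pt n ` parity_pairs (even (a + b)) {0..2*n}"
proof -
  have "0 \<le> real_of_int a" "0 \<le> real_of_int b"
    "real_of_int a \<le> real_of_int (2 * int n)" "real_of_int b \<le> real_of_int (2 * int n)"
    using assms unfolding l1_ball_iff by simp_all
  then have ab: "0 \<le> a" "0 \<le> b" "a \<le> 2 * int n" "b \<le> 2 * int n"
    by (simp_all only: of_int_le_iff of_int_0_le_iff)
  then have "p = lattice_pt n (nat a, nat b)" using assms by (intro lattice_pt_eqI) auto
  moreover have "even (nat a + nat b) \<longleftrightarrow> even (a + b)" using ab by (simp add: even_nat_iff)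
  moreover have "nat a \<le> 2*n" "nat b \<le> 2*n" using ab by simp_all
  ultimately show ?thesis unfolding parity_pairs_def by auto
qed

lemma lattice_pt_in_ball: "u \<le> 2*n \<Longrightarrow> v \<le> 2*n \<Longrightarrow> lattice_pt n (u, v) \<in> l1_ball n"
  unfolding l1_ball_iff by simp

lemma int_lattice_ball: "int_lattice \<inter> l1_ball n = lattice_pt n ` parity_pairs True {0..2*n}"
proof (intro equalityI subsetI)
  fix p assume p: "p \<in> int_lattice \<inter> l1_ball n"
  then obtain a b where ab: "p = (of_int a, of_int b)"
    unfolding int_lattice_def by (auto elim!: Ints_cases)
  have "p \<in> lattice_pt n ` parity_pairs (even ((a + b + int n) + (a - b + int n))) {0..2*n}"
    using p ab by (intro l1_ball_lattice_pt) (auto simp: ucoord_def vcoord_def)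
  then show "p \<in> lattice_pt n ` parity_pairs True {0..2*n}" by simp
next
  fix p assume "p \<in> lattice_pt n ` parity_pairs True {0..2*n}"
  then obtain u v where uv: "p = lattice_pt n (u, v)" "u \<le> 2*n" "v \<le> 2*n" "even (u + v)"
    unfolding parity_pairs_def by auto
  then obtain m where "u + v = 2 * m" by (elim evenE)
  then have "real u = 2 * real m - real v" by linarith
  then have "p = (of_int (int m - int n), of_int (int m - int v))"
    unfolding uv(1) lattice_pt_def by (simp add: field_simps)
  then have "p \<in> int_lattice" unfolding int_lattice_def by auto
  then show "p \<in> int_lattice \<inter> l1_ball n" using lattice_pt_in_ball uv(1-3) by auto
qed

lemma half_int_lattice_ball:
  "half_int_lattice \<inter> l1_ball n = lattice_pt n ` parity_pairs False {0..2*n}"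
proof (intro equalityI subsetI)
  fix p assume p: "p \<in> half_int_lattice \<inter> l1_ball n"
  then obtain a b where "fst p - 1/2 = of_int a" "snd p - 1/2 = of_int b"
    unfolding half_int_lattice_def by (auto elim!: Ints_cases)
  then have ab: "p = (of_int a + 1/2, of_int b + 1/2)" by (auto simp: prod_eq_iff)
  \<comment> \<open>The two halves add up to 1 in the coordinate \<open>u\<close> and cancel in
    \<open>v\<close>, which makes \<open>u + v\<close> odd.\<close>
  have "p \<in> lattice_pt n ` parity_pairs (even ((a + b + 1 + int n) + (a - b + int n))) {0..2*n}"
    using p ab by (intro l1_ball_lattice_pt) (auto simp: ucoord_def vcoord_def)
  then show "p \<in> lattice_pt n ` parity_pairs False {0..2*n}" by simp
next
  fix p assume "p \<in> lattice_pt n ` parity_pairs False {0..2*n}"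
  then obtain u v where uv: "p = lattice_pt n (u, v)" "u \<le> 2*n" "v \<le> 2*n" "odd (u + v)"
    unfolding parity_pairs_def by auto
  then obtain m where "u + v = 2 * m + 1" by (elim oddE)
  then have "real u = 2 * real m + 1 - real v" by linarith
  then have "p = (of_int (int m - int n) + 1/2, of_int (int m - int v) + 1/2)"
    unfolding uv(1) lattice_pt_def by (simp add: field_simps)
  then have "p \<in> half_int_lattice" unfolding half_int_lattice_def by auto
  then show "p \<in> half_int_lattice \<inter> l1_ball n" using lattice_pt_in_ball uv(1-3) by auto
qed

lemma induced_grid:
  "induced_subgraph (grid L) S = \<lparr>verts = L \<inter> S,
     edges = {{p, q} | p q. p \<in> L \<inter> S \<and> q \<in> L \<inter> S \<and> dist p q = 1}, ends = (\<lambda>e. e)\<rparr>"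
proof -
  have "{e \<in> {{p, q} | p q. p \<in> L \<and> q \<in> L \<and> dist p q = 1}. e \<subseteq> S} =
      {{p, q} | p q. p \<in> L \<inter> S \<and> q \<in> L \<inter> S \<and> dist p q = 1}" by blast
  then show ?thesis unfolding induced_subgraph_def grid_def by simp
qed

lemma odd_aztec_diamond_eq: "odd_aztec_diamond n = diamond n True"
  unfolding odd_aztec_diamond_def induced_grid int_lattice_ball diamond_def ..

lemma aztec_diamond_eq: "aztec_diamond n = diamond n False"
  unfolding aztec_diamond_def induced_grid half_int_lattice_ball diamond_def ..

lemma verts_diamond: "verts (diamond n ev) = lattice_pt n ` parity_pairs ev {0..2*n}"
  by (simp add: diamond_def)

lemma finite_multigraph_diamond: "finite_multigraph (diamond n ev)"
proof -
  let ?V = "lattice_pt n ` parity_pairs ev {0..2*n}"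
  have V: "finite ?V" by (simp add: finite_parity_pairs)
  have "edges (diamond n ev) \<subseteq> (\<lambda>(p, q). {p, q}) ` (?V \<times> ?V)" unfolding diamond_def by auto
  then have "finite (edges (diamond n ev))" using V by (meson finite_SigmaI finite_imageI finite_subset)
  moreover have "\<forall>e \<in> edges (diamond n ev). \<exists>a \<in> ?V. \<exists>b \<in> ?V. e = {a, b}"
    unfolding diamond_def by (simp only: multigraph.select_convs) blast
  ultimately show ?thesis using V unfolding finite_multigraph_def by (simp add: diamond_def)
qed

lemma lattice_pt_in_sphere_iff:
  assumes "u \<le> 2*n" "v \<le> 2*n"
  shows "lattice_pt n (u, v) \<in> l1_sphere n \<longleftrightarrow> u = 0 \<or> u = 2*n \<or> v = 0 \<or> v = 2*n"
proof -
  have "p \<in> l1_sphere n \<longleftrightarrow> p \<in> l1_ball n \<and>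
      (ucoord n p = 0 \<or> ucoord n p = 2 * real n \<or> vcoord n p = 0 \<or> vcoord n p = 2 * real n)" for p
    unfolding l1_sphere_def l1_ball_def ucoord_def vcoord_def
    by (cases p) (auto simp: abs_if split: if_splits)
  moreover have "real u = 2 * real n \<longleftrightarrow> u = 2*n" "real v = 2 * real n \<longleftrightarrow> v = 2*n" by linarith+
  ultimately show ?thesis using lattice_pt_in_ball[OF assms] by simp
qed

text \<open>The squared distance is half of the squared distance in the \<open>(u, v)\<close>
  coordinates, and 2 is a sum of two integer squares only as 1 + 1.\<close>

lemma dist_lattice_pt:
  "dist (lattice_pt n (u, v)) (lattice_pt n (u', v')) = 1 \<longleftrightarrow>
    (u' = Suc u \<or> u = Suc u') \<and> (v' = Suc v \<or> v = Suc v')"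
proof -
  define a b where "a = int u - int u'" and "b = int v - int v'"
  have sq: "x\<^sup>2 + y\<^sup>2 = 2 \<longleftrightarrow> (x = 1 \<or> x = -1) \<and> (y = 1 \<or> y = -1)" for x y :: int
  proof
    assume e: "x\<^sup>2 + y\<^sup>2 = 2"
    have small: "\<bar>z\<bar> < 2" if "z\<^sup>2 \<le> 2" for z :: int
    proof (rule ccontr)
      assume "\<not> \<bar>z\<bar> < 2"
      then have "2\<^sup>2 \<le> \<bar>z\<bar>\<^sup>2" by (intro power_mono) auto
      then show False using that by simp
    qed
    have "x\<^sup>2 \<le> 2" "y\<^sup>2 \<le> 2" using e zero_le_power2[of x] zero_le_power2[of y] by linarith+
    then have "\<bar>x\<bar> < 2" "\<bar>y\<bar> < 2" by (simp_all only: small)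
    then have "x \<in> {-1, 0, 1}" "y \<in> {-1, 0, 1}" by auto
    then show "(x = 1 \<or> x = -1) \<and> (y = 1 \<or> y = -1)" using e by auto
  qed auto
  have "dist (lattice_pt n (u, v)) (lattice_pt n (u', v')) =
      sqrt ((((real u - real u') + (real v - real v')) / 2)\<^sup>2 + (((real u - real u') - (real v - real v')) / 2)\<^sup>2)"
    unfolding lattice_pt_def dist_Pair_Pair prod.case dist_real_def power2_abs
    by (intro arg_cong[of _ _ sqrt] arg_cong2[of _ _ _ _ "(+)"] arg_cong[of _ _ "\<lambda>x. x\<^sup>2"])
       (simp_all add: field_simps)
  also have "\<dots> = sqrt (((real u - real u')\<^sup>2 + (real v - real v')\<^sup>2) / 2)"
    by (intro arg_cong[of _ _ sqrt]) (simp add: power2_eq_square field_simps)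
  also have "\<dots> = sqrt (of_int (a\<^sup>2 + b\<^sup>2) / 2)" by (simp add: a_def b_def)
  finally have "dist (lattice_pt n (u, v)) (lattice_pt n (u', v')) = 1 \<longleftrightarrow> real_of_int (a\<^sup>2 + b\<^sup>2) / 2 = 1"
    by (simp only: real_sqrt_eq_1_iff)
  also have "\<dots> \<longleftrightarrow> real_of_int (a\<^sup>2 + b\<^sup>2) = real_of_int 2" by (simp add: field_simps)
  also have "\<dots> \<longleftrightarrow> a\<^sup>2 + b\<^sup>2 = 2" by (rule of_int_eq_iff)
  also have "\<dots> \<longleftrightarrow> (u' = Suc u \<or> u = Suc u') \<and> (v' = Suc v \<or> v = Suc v')"
    unfolding sq a_def b_def by auto
  finally show ?thesis .
qed

text \<open>The diamond is a parity class of the tensor product of two paths on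
  \<open>{0..2*n}\<close>.\<close>

definition path_nbrs :: "nat \<Rightarrow> nat \<Rightarrow> nat set" where
  "path_nbrs n u = {u' \<in> {0..2*n}. u' = Suc u \<or> u = Suc u'}"

lemma unit_edges_at:
  fixes x :: "'a :: metric_space"
  assumes x: "x \<in> V"
  shows "{e \<in> {{p, q} | p q. p \<in> V \<and> q \<in> V \<and> dist p q = 1}. x \<in> e} =
    (\<lambda>q. {x, q}) ` {q \<in> V. dist x q = 1}"
proof (intro equalityI subsetI)
  fix e assume "e \<in> {e \<in> {{p, q} | p q. p \<in> V \<and> q \<in> V \<and> dist p q = 1}. x \<in> e}"
  then obtain p q where pq: "e = {p, q}" "p \<in> V" "q \<in> V" "dist p q = 1" "x = p \<or> x = q" by auto
  from pq(5) obtain y where "e = {x, y}" "y \<in> V" "dist x y = 1"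
  proof
    assume "x = p"
    then show thesis using that pq(1-4) by simp
  next
    assume "x = q"
    then show thesis using that[of p] pq(1-4) by (simp add: insert_commute dist_commute)
  qed
  then show "e \<in> (\<lambda>q. {x, q}) ` {q \<in> V. dist x q = 1}" by simp
qed (use x in auto)

text \<open>Both coordinates change by one, so neighbours keep the parity of \<open>u + v\<close>
  and the neighbourhood is a full product.\<close>

lemma laplacian_diamond:
  assumes uv: "(u, v) \<in> parity_pairs ev {0..2*n}"
  shows "laplacian (ends (diamond n ev)) (edges (diamond n ev)) f (lattice_pt n (u, v)) =
    (\<Sum>u' \<in> path_nbrs n u. \<Sum>v' \<in> path_nbrs n v. f (lattice_pt n (u, v)) - f (lattice_pt n (u', v')))"
proof -
  let ?V = "lattice_pt n ` parity_pairs ev {0..2*n}" and ?p = "lattice_pt n (u, v)"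
  let ?N = "{q \<in> ?V. dist ?p q = 1}"
  have edges: "{e \<in> edges (diamond n ev). ?p \<in> ends (diamond n ev) e} = (\<lambda>q. {?p, q}) ` ?N"
    using unit_edges_at[OF imageI[OF uv, of "lattice_pt n"]] unfolding diamond_def
    by (simp only: multigraph.select_convs)
  have inj: "inj_on (\<lambda>q. {?p, q}) ?N" by (intro inj_onI) (auto simp: doubleton_eq_iff)
  have "laplacian (ends (diamond n ev)) (edges (diamond n ev)) f ?p =
      (\<Sum>q \<in> ?N. \<Sum>w \<in> {?p, q}. f ?p - f w)"
    unfolding laplacian_def edges by (subst sum.reindex[OF inj]) (simp add: diamond_def)
  also have "\<dots> = (\<Sum>q \<in> ?N. f ?p - f q)"
  proof (intro sum.cong refl)
    fix q assume "q \<in> ?N"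
    then have "?p \<noteq> q" by auto
    then show "(\<Sum>w \<in> {?p, q}. f ?p - f w) = f ?p - f q" by simp
  qed
  finally have "laplacian (ends (diamond n ev)) (edges (diamond n ev)) f ?p = (\<Sum>q \<in> ?N. f ?p - f q)" .
  moreover have "?N = lattice_pt n ` (path_nbrs n u \<times> path_nbrs n v)"
  proof -
    have "{a \<in> parity_pairs ev {0..2*n}. dist ?p (lattice_pt n a) = 1} = path_nbrs n u \<times> path_nbrs n v"
      using uv by (auto simp: dist_lattice_pt path_nbrs_def parity_pairs_def)
    moreover have "?N = lattice_pt n ` {a \<in> parity_pairs ev {0..2*n}. dist ?p (lattice_pt n a) = 1}"
      by blast
    ultimately show ?thesis by (simp only:)
  qed
  moreover have "(\<Sum>q \<in> lattice_pt n ` (path_nbrs n u \<times> path_nbrs n v). f ?p - f q) =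
      (\<Sum>a \<in> path_nbrs n u \<times> path_nbrs n v. f ?p - f (lattice_pt n a))"
    using inj_lattice_pt by (subst sum.reindex) (auto intro: inj_on_subset)
  ultimately show ?thesis by (simp only: sum.cartesian_product split_def) simp
qed

lemma path_nbrs_eq:
  assumes "n \<ge> 1" "u \<le> 2*n"
  shows "path_nbrs n u = (if u = 0 then {1} else if u = 2*n then {2*n - 1} else {u - 1, u + 1})"
  using assms unfolding path_nbrs_def by auto

text \<open>Origin of the weights: a point of the diamond has degree 4 times the product of its two
  end weights, on the boundary as well.\<close>

lemma card_path_nbrs:
  assumes "n \<ge> 1" "u \<le> 2*n"
  shows "real (card (path_nbrs n u)) = 2 * end_weight n (real u)"
  using assms by (simp add: path_nbrs_eq end_weight_of_nat)

text \<open>Inside, this is the addition theorem. The cosine modes are even about 0 and about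
  \<open>2n\<close>, so at an end the missing neighbour would have the value of the existing one;
  leaving it out halves the sum, as the weight does.\<close>

lemma sum_path_nbrs_cos_mode:
  assumes n: "n \<ge> 1" and u: "u \<le> 2*n"
  shows "(\<Sum>u' \<in> path_nbrs n u. cos_mode n j (real u')) =
    2 * end_weight n (real u) * cos (real j * pi / (2 * real n)) * cos_mode n j (real u)"
proof -
  define a where "a = real j * pi / (2 * real n)"
  have m: "cos_mode n j t = cos (a * t)" for t by (simp add: cos_mode_def a_def)
  have full: "a * (2 * real n) = real j * pi" using n by (simp add: a_def)
  consider "u = 0" | "u = 2*n" "u \<noteq> 0" | "u \<noteq> 0" "u \<noteq> 2*n" by blast
  then show ?thesis
  proof cases
    case 2
    have "real (2*n - 1) = 2 * real n - 1" using n by (simp add: of_nat_diff)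
    then have "cos (a * real (2*n - 1)) = cos (real j * pi - a)"
      unfolding full[symmetric] by (simp add: algebra_simps)
    then show ?thesis using 2 n
      by (simp add: path_nbrs_eq end_weight_def m a_def[symmetric] full cos_diff)
  next
    case 3
    have "cos (a * real (u - 1)) + cos (a * real (u + 1)) = 2 * cos a * cos (a * real u)"
    proof -
      have "a * real (u - 1) = a * real u - a" "a * real (u + 1) = a * real u + a"
        using 3 by (simp_all add: of_nat_diff algebra_simps)
      then show ?thesis unfolding cos_add cos_diff by (simp add: cos_add cos_diff)
    qed
    then show ?thesis using 3 n u by (simp add: path_nbrs_eq end_weight_of_nat m a_def[symmetric])
  qed (use n in \<open>simp add: path_nbrs_eq end_weight_def m a_def[symmetric]\<close>)
qed

text \<open>Confined to interior points: at an end the mode is 0 while its neighbour in general is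
  not. On the seam the two sheets compensate for this.\<close>

lemma sum_path_nbrs_sin_mode:
  assumes n: "n \<ge> 1" and u: "0 < u" "u < 2*n"
  shows "(\<Sum>u' \<in> path_nbrs n u. sin_mode n j (real u')) =
    2 * cos (real j * pi / (2 * real n)) * sin_mode n j (real u)"
proof -
  define a where "a = real j * pi / (2 * real n)"
  have m: "sin_mode n j t = sin (a * t)" for t by (simp add: sin_mode_def a_def)
  have "a * real (u - 1) = a * real u - a" "a * real (u + 1) = a * real u + a"
    using u by (simp_all add: of_nat_diff algebra_simps)
  then have "sin (a * real (u - 1)) + sin (a * real (u + 1)) = 2 * cos a * sin (a * real u)"
    by (simp add: sin_add sin_diff)
  then show ?thesis using n u by (simp add: path_nbrs_eq m a_def[symmetric])
qed

lemma laplacian_diamond_product: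
  assumes uv: "(u, v) \<in> parity_pairs ev {0..2*n}" and n: "n \<ge> 1"
  shows "laplacian (ends (diamond n ev)) (edges (diamond n ev))
      (\<lambda>p. g (ucoord n p) * h (vcoord n p)) (lattice_pt n (u, v)) =
    4 * end_weight n (real u) * end_weight n (real v) * (g (real u) * h (real v)) -
      (\<Sum>u' \<in> path_nbrs n u. g (real u')) * (\<Sum>v' \<in> path_nbrs n v. h (real v'))"
proof -
  have b: "u \<le> 2*n" "v \<le> 2*n" using uv by (auto simp: parity_pairs_def)
  show ?thesis
    unfolding laplacian_diamond[OF uv]
    by (simp add: sum_subtractf sum_product card_path_nbrs[OF n] b)
qed

section \<open>Modes of the pillowcase\<close>

definition mode_eigenvalue :: "nat \<Rightarrow> nat \<times> nat \<Rightarrow> real" where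
  "mode_eigenvalue n =
    (\<lambda>(j, k). 4 - 4 * cos (real j * pi / (2 * real n)) * cos (real k * pi / (2 * real n)))"

definition point_weight :: "nat \<Rightarrow> real \<times> real \<Rightarrow> real" where
  "point_weight n p = end_weight n (ucoord n p) * end_weight n (vcoord n p)"

text \<open>For \<open>n \<ge> 1\<close>, a quarter of the degree of the vertex \<open>C\<close>: 1
  everywhere except at the four corners of the odd pillowcase, where it is 1/2.\<close>

definition pillow_weight :: "nat \<Rightarrow> ((real \<times> real) \<times> bool) set \<Rightarrow> real" where
  "pillow_weight n C = (\<Sum>x \<in> C. point_weight n (fst x))"

text \<open>The sheets differ by the sign of one torus coordinate, so the sine product is odd under
  their exchange and the cosine product even.\<close>

fun pillow_mode :: "nat \<Rightarrow> bool \<times> nat \<times> nat \<Rightarrow> real \<times> real \<Rightarrow> bool \<Rightarrow> real" where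
  "pillow_mode n (True, j, k) p b = cos_mode n j (ucoord n p) * cos_mode n k (vcoord n p)"
| "pillow_mode n (False, j, k) p b =
    (if b then 1 else -1) * (sin_mode n j (ucoord n p) * sin_mode n k (vcoord n p))"

definition pillow_modes :: "nat \<Rightarrow> bool \<Rightarrow> (bool \<times> nat \<times> nat) set" where
  "pillow_modes n ev =
    {True} \<times> half_square n ev {0..2*n} \<union> {False} \<times> half_square n ev {1..2*n - 1}"

text \<open>The choice of the representative is immaterial because the sine modes vanish on the sphere along
  which the sheets are glued.\<close>

definition class_mode ::
    "nat \<Rightarrow> bool \<times> nat \<times> nat \<Rightarrow> ((real \<times> real) \<times> bool) set \<Rightarrow> real" where
  "class_mode n i C = (let x = SOME x. x \<in> C in pillow_mode n i (fst x) (snd x))"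

lemma sin_mode_ends: "sin_mode n j 0 = 0" "n \<ge> 1 \<Longrightarrow> sin_mode n j (2 * real n) = 0"
  by (simp_all add: sin_mode_def)

lemma sin_modes_sphere:
  assumes n: "n \<ge> 1" and p: "p \<in> verts (diamond n ev)" "p \<in> l1_sphere n"
  shows "sin_mode n j (ucoord n p) * sin_mode n k (vcoord n p) = 0"
proof -
  obtain u v where uv: "p = lattice_pt n (u, v)" "u \<le> 2*n" "v \<le> 2*n"
    using p(1) unfolding verts_diamond parity_pairs_def by auto
  have "u = 0 \<or> u = 2*n \<or> v = 0 \<or> v = 2*n"
    using p(2) lattice_pt_in_sphere_iff[OF uv(2,3)] uv(1) by simp
  then show ?thesis unfolding uv(1) by (auto simp: sin_mode_ends(1) sin_mode_ends(2)[OF n])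
qed

lemma class_mode_eq:
  assumes n: "n \<ge> 1" and p: "p \<in> verts (diamond n ev)"
  shows "class_mode n i (pillow_class (l1_sphere n) (p, b)) = pillow_mode n i p b"
proof -
  let ?C = "pillow_class (l1_sphere n) (p, b)"
  define x where "x = (SOME x. x \<in> ?C)"
  have "(p, b) \<in> ?C" by (simp add: pillow_class_def)
  then have "x \<in> ?C" unfolding x_def by (rule someI)
  then have x: "fst x = p" "snd x = b \<or> p \<in> l1_sphere n" by (auto simp: pillow_class_def)
  have "pillow_mode n i p (snd x) = pillow_mode n i p b"
  proof (cases "snd x = b")
    case False
    then have "p \<in> l1_sphere n" using x(2) by simp
    note z = sin_modes_sphere[OF n p this]
    show ?thesis
    proof (cases i)
      case (fields c j k)
      then show ?thesis using z[of j k] by (cases c) (simp_all del: mult_eq_0_iff)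
    qed
  qed simp
  then show ?thesis unfolding class_mode_def Let_def x_def[symmetric] x(1) .
qed

lemma sum_diamond_pillow:
  "(\<Sum>C \<in> verts (pillowcase (diamond n ev) B). \<Sum>x \<in> C. f (fst x) (snd x)) =
    (\<Sum>(u, v) \<in> parity_pairs ev {0..2*n}. f (lattice_pt n (u, v)) True + f (lattice_pt n (u, v)) False)"
proof -
  have "(\<Sum>C \<in> verts (pillowcase (diamond n ev) B). \<Sum>x \<in> C. f (fst x) (snd x)) =
      (\<Sum>p \<in> verts (diamond n ev). f p True + f p False)"
    unfolding sum_pillow_classes[OF finite_multigraphD(1)[OF finite_multigraph_diamond]]
    by (simp add: UNIV_bool add.commute)
  also have "\<dots> = (\<Sum>a \<in> parity_pairs ev {0..2*n}. f (lattice_pt n a) True + f (lattice_pt n a) False)"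
    unfolding verts_diamond using inj_lattice_pt by (subst sum.reindex) (auto intro: inj_on_subset)
  finally show ?thesis by (simp add: split_def)
qed

section \<open>Inner products of the modes\<close>

definition cos_gram :: "nat \<Rightarrow> nat \<Rightarrow> nat \<Rightarrow> real" where
  "cos_gram n j k = (\<Sum>u\<le>2*n. end_weight n (real u) * (cos_mode n j (real u) * cos_mode n k (real u)))"

definition sin_gram :: "nat \<Rightarrow> nat \<Rightarrow> nat \<Rightarrow> real" where
  "sin_gram n j k = (\<Sum>u\<le>2*n. end_weight n (real u) * (sin_mode n j (real u) * sin_mode n k (real u)))"

text \<open>The alternating signs of \<open>sum_parity_pairs\<close> are absorbed by reflecting
  \<open>j'\<close> and \<open>k'\<close>.\<close>

lemma parity_cos_gram:
  assumes n: "n \<ge> 1" and jk: "j' \<le> 2*n" "k' \<le> 2*n"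
  shows "(\<Sum>(u, v) \<in> parity_pairs ev {0..2*n}.
      (end_weight n (real u) * (cos_mode n j (real u) * cos_mode n j' (real u))) *
      (end_weight n (real v) * (cos_mode n k (real v) * cos_mode n k' (real v)))) =
    (cos_gram n j j' * cos_gram n k k' +
      (if ev then 1 else -1) * cos_gram n j (2*n - j') * cos_gram n k (2*n - k')) / 2"
proof -
  have r: "(\<Sum>u\<le>2*n. (-1)^u * (end_weight n (real u) * (cos_mode n i (real u) * cos_mode n i' (real u)))) =
      cos_gram n i (2*n - i')" if "i' \<le> 2*n" for i i'
    unfolding cos_gram_def cos_mode_reflect[OF n that] by (intro sum.cong refl) simp
  show ?thesis
    unfolding sum_parity_pairs[OF finite_atLeastAtMost] unfolding atLeast0AtMost r[OF jk(1)] r[OF jk(2)]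
      cos_gram_def[symmetric] ..
qed

lemma parity_sin_gram:
  assumes n: "n \<ge> 1" and jk: "j' \<le> 2*n" "k' \<le> 2*n"
  shows "(\<Sum>(u, v) \<in> parity_pairs ev {0..2*n}.
      (end_weight n (real u) * (sin_mode n j (real u) * sin_mode n j' (real u))) *
      (end_weight n (real v) * (sin_mode n k (real v) * sin_mode n k' (real v)))) =
    (sin_gram n j j' * sin_gram n k k' +
      (if ev then 1 else -1) * sin_gram n j (2*n - j') * sin_gram n k (2*n - k')) / 2"
proof -
  have r: "(\<Sum>u\<le>2*n. (-1)^u * (end_weight n (real u) * (sin_mode n i (real u) * sin_mode n i' (real u)))) =
      - sin_gram n i (2*n - i')" if "i' \<le> 2*n" for i i'
    unfolding sin_gram_def sin_mode_reflect[OF n that] sum_negf[symmetric] by (intro sum.cong refl) simp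
  show ?thesis
    unfolding sum_parity_pairs[OF finite_atLeastAtMost] unfolding atLeast0AtMost r[OF jk(1)] r[OF jk(2)]
      sin_gram_def[symmetric] by simp
qed

lemma pillow_gram:
  assumes n: "n \<ge> 1"
  shows "(\<Sum>C \<in> verts (pillowcase (diamond n ev) (l1_sphere n)).
      pillow_weight n C * class_mode n i C * class_mode n i' C) =
    (\<Sum>(u, v) \<in> parity_pairs ev {0..2*n}. end_weight n (real u) * end_weight n (real v) *
      (pillow_mode n i (lattice_pt n (u, v)) True * pillow_mode n i' (lattice_pt n (u, v)) True +
       pillow_mode n i (lattice_pt n (u, v)) False * pillow_mode n i' (lattice_pt n (u, v)) False))"
proof -
  let ?G = "diamond n ev" and ?B = "l1_sphere n"
  have "(\<Sum>C \<in> verts (pillowcase ?G ?B). pillow_weight n C * class_mode n i C * class_mode n i' C) =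
      (\<Sum>C \<in> verts (pillowcase ?G ?B). \<Sum>x \<in> C. point_weight n (fst x) *
        (pillow_mode n i (fst x) (snd x) * pillow_mode n i' (fst x) (snd x)))"
  proof (intro sum.cong refl)
    fix C assume C: "C \<in> verts (pillowcase ?G ?B)"
    have m: "class_mode n l C = pillow_mode n l (fst x) (snd x)" if "x \<in> C" for l x
    proof -
      have x: "fst x \<in> verts ?G" "C = pillow_class ?B (fst x, snd x)"
        using pillow_class_member[OF C that] by simp_all
      show ?thesis using class_mode_eq[OF n x(1), of l "snd x"] x(2) by simp
    qed
    show "pillow_weight n C * class_mode n i C * class_mode n i' C =
        (\<Sum>x \<in> C. point_weight n (fst x) *
          (pillow_mode n i (fst x) (snd x) * pillow_mode n i' (fst x) (snd x)))"
      unfolding pillow_weight_def sum_distrib_right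
      by (intro sum.cong refl) (simp only: m mult.assoc)
  qed
  also have "\<dots> = (\<Sum>(u, v) \<in> parity_pairs ev {0..2*n}. end_weight n (real u) * end_weight n (real v) *
      (pillow_mode n i (lattice_pt n (u, v)) True * pillow_mode n i' (lattice_pt n (u, v)) True +
       pillow_mode n i (lattice_pt n (u, v)) False * pillow_mode n i' (lattice_pt n (u, v)) False))"
    unfolding sum_diamond_pillow[where f = "\<lambda>p b. point_weight n p * (pillow_mode n i p b * pillow_mode n i' p b)"]
    by (simp add: point_weight_def distrib_left)
  finally show ?thesis .
qed

lemma pillow_gram_cos:
  assumes n: "n \<ge> 1" and jk: "j' \<le> 2*n" "k' \<le> 2*n"
  shows "(\<Sum>C \<in> verts (pillowcase (diamond n ev) (l1_sphere n)).
      pillow_weight n C * class_mode n (True, j, k) C * class_mode n (True, j', k') C) =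
    2 * ((cos_gram n j j' * cos_gram n k k' +
      (if ev then 1 else -1) * cos_gram n j (2*n - j') * cos_gram n k (2*n - k')) / 2)"
  unfolding pillow_gram[OF n] parity_cos_gram[OF n jk, symmetric] sum_distrib_left
  by (intro sum.cong refl) (simp add: split_def)

lemma pillow_gram_sin:
  assumes n: "n \<ge> 1" and jk: "j' \<le> 2*n" "k' \<le> 2*n"
  shows "(\<Sum>C \<in> verts (pillowcase (diamond n ev) (l1_sphere n)).
      pillow_weight n C * class_mode n (False, j, k) C * class_mode n (False, j', k') C) =
    2 * ((sin_gram n j j' * sin_gram n k k' +
      (if ev then 1 else -1) * sin_gram n j (2*n - j') * sin_gram n k (2*n - k')) / 2)"
  unfolding pillow_gram[OF n] parity_sin_gram[OF n jk, symmetric] sum_distrib_left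
  by (intro sum.cong refl) (simp add: split_def)

text \<open>Cancels point by point: the two sheets contribute opposite values.\<close>

lemma pillow_gram_mixed:
  assumes n: "n \<ge> 1" and "c \<noteq> c'"
  shows "(\<Sum>C \<in> verts (pillowcase (diamond n ev) (l1_sphere n)).
      pillow_weight n C * class_mode n (c, j, k) C * class_mode n (c', j', k') C) = 0"
  unfolding pillow_gram[OF n] using assms(2) by (cases c; cases c') (simp_all add: split_def)

lemma pillow_modes_orthogonal:
  assumes n: "n \<ge> 1" and i: "i \<in> pillow_modes n ev" and i': "i' \<in> pillow_modes n ev"
  defines "g \<equiv> (\<Sum>C \<in> verts (pillowcase (diamond n ev) (l1_sphere n)).
      pillow_weight n C * class_mode n i C * class_mode n i' C)"
  shows "i \<noteq> i' \<Longrightarrow> g = 0" "i = i' \<Longrightarrow> g \<noteq> 0"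
proof -
  obtain c j k where ic: "i = (c, j, k)" by (cases i)
  obtain c' j' k' where ic': "i' = (c', j', k')" by (cases i')
  \<comment> \<open>The bound \<open>2*n - 0\<close> matches \<open>half_square_gram\<close> at
    \<open>a = 0\<close> syntactically.\<close>
  have c: "cos_gram n a b = 0" if "a \<in> {0..2*n - 0}" "b \<in> {0..2*n - 0}" "a \<noteq> b" for a b
    using cos_mode_orthogonal[OF n] that unfolding cos_gram_def by auto
  have s: "sin_gram n a b = 0" if "a \<in> {1..2*n - 1}" "b \<in> {1..2*n - 1}" "a \<noteq> b" for a b
    using sin_mode_orthogonal[OF n] that unfolding sin_gram_def by auto
  have cp: "cos_gram n a a > 0" if "a \<in> {0..2*n - 0}" for a
    unfolding cos_gram_def by (rule cos_mode_norm_pos)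
  have sp: "sin_gram n a a > 0" if "a \<in> {1..2*n - 1}" for a
    unfolding sin_gram_def by (rule sin_mode_norm_pos[OF that])
  have "(i \<noteq> i' \<longrightarrow> g = 0) \<and> (i = i' \<longrightarrow> g \<noteq> 0)"
  proof (cases "c = c'")
    case False
    then have "g = 0" unfolding g_def ic ic' by (rule pillow_gram_mixed[OF n])
    then show ?thesis using False ic ic' by simp
  next
    case cc: True
    show ?thesis
    proof (cases c)
      case True
      have jk: "(j, k) \<in> half_square n ev {0..2*n - 0}" "(j', k') \<in> half_square n ev {0..2*n - 0}"
        using i i' cc True unfolding ic ic' pillow_modes_def by auto
      then have b: "j' \<le> 2*n" "k' \<le> 2*n" by (auto simp: half_square_def)
      have g: "g = 2 * ((cos_gram n j j' * cos_gram n k k' + (if ev then 1 else -1) *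
          cos_gram n j (2*n - j') * cos_gram n k (2*n - k')) / 2)"
        using cc True unfolding g_def ic ic' by (simp only: pillow_gram_cos[OF n b])
      show ?thesis
        using half_square_gram[of 0 n "cos_gram n", OF c cp jk] cc True unfolding g ic ic' by auto
    next
      case False
      have jk: "(j, k) \<in> half_square n ev {1..2*n - 1}" "(j', k') \<in> half_square n ev {1..2*n - 1}"
        using i i' cc False unfolding ic ic' pillow_modes_def by auto
      then have b: "j' \<le> 2*n" "k' \<le> 2*n" by (auto simp: half_square_def)
      have g: "g = 2 * ((sin_gram n j j' * sin_gram n k k' + (if ev then 1 else -1) *
          sin_gram n j (2*n - j') * sin_gram n k (2*n - k')) / 2)"
        using cc False unfolding g_def ic ic' by (simp only: pillow_gram_sin[OF n b])
      show ?thesis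
        using half_square_gram[of 1 n "sin_gram n", OF s sp jk] cc False unfolding g ic ic' by auto
    qed
  qed
  then show "i \<noteq> i' \<Longrightarrow> g = 0" "i = i' \<Longrightarrow> g \<noteq> 0" by auto
qed

lemma laplacian_scale: "laplacian en E (\<lambda>q. a * f q) u = a * laplacian en E f u"
  unfolding laplacian_def by (simp add: sum_distrib_left right_diff_distrib)

text \<open>Cosine products satisfy the equation on each sheet already. Sine products do so off the
  seam, where a class lies in one sheet; on the seam the mode is 0 and the contributions of the two
  sheets are opposite.\<close>

lemma pillow_mode_eigen:
  assumes n: "n \<ge> 1" and C: "C \<in> verts (pillowcase (diamond n ev) (l1_sphere n))"
  shows "laplacian (ends (pillowcase (diamond n ev) (l1_sphere n)))
      (edges (pillowcase (diamond n ev) (l1_sphere n))) (class_mode n i) C =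
    mode_eigenvalue n (snd i) * pillow_weight n C * class_mode n i C"
proof -
  let ?G = "diamond n ev" and ?B = "l1_sphere n"
  obtain p b where p: "p \<in> verts ?G" "C = pillow_class ?B (p, b)"
    using C unfolding verts_pillowcase by auto
  obtain u v where uv: "p = lattice_pt n (u, v)" "(u, v) \<in> parity_pairs ev {0..2*n}"
    using p(1) unfolding verts_diamond by auto
  have uv2: "u \<le> 2*n" "v \<le> 2*n" using uv(2) by (auto simp: parity_pairs_def)
  obtain c j k where i: "i = (c, j, k)" by (cases i)
  let ?K = "{c. c = b \<or> p \<in> ?B}"
  let ?lap = "laplacian (ends ?G) (edges ?G)"
  have K: "(\<Sum>x \<in> C. f (fst x) (snd x)) = (\<Sum>c \<in> ?K. f p c)" for f :: "_ \<Rightarrow> _ \<Rightarrow> real"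
    unfolding p(2) pillow_class_def by (rule sum.reindex_cong[of "\<lambda>c. (p, c)"]) (auto intro!: inj_onI)
  have lap: "laplacian (ends (pillowcase ?G ?B)) (edges (pillowcase ?G ?B)) (class_mode n i) C =
      (\<Sum>c \<in> ?K. ?lap (\<lambda>q. pillow_mode n i q c) p)"
  proof -
    have "laplacian (ends (pillowcase ?G ?B)) (edges (pillowcase ?G ?B)) (class_mode n i)
        (pillow_class ?B (p, b)) =
        (\<Sum>x \<in> pillow_class ?B (p, b). ?lap (\<lambda>q. pillow_mode n i q (snd x)) (fst x))"
      by (rule laplacian_pillowcase[OF finite_multigraph_diamond p(1)]) (rule class_mode_eq[OF n])
    also have "\<dots> = (\<Sum>c \<in> ?K. ?lap (\<lambda>q. pillow_mode n i q c) p)"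
      using K[of "\<lambda>q c. ?lap (\<lambda>q. pillow_mode n i q c) q"] unfolding p(2) .
    finally show ?thesis unfolding p(2) .
  qed
  have w: "pillow_weight n C = (\<Sum>c \<in> ?K. point_weight n p)"
    unfolding pillow_weight_def using K[of "\<lambda>p c. point_weight n p"] .
  have m: "class_mode n i C = pillow_mode n i p b" unfolding p(2) by (rule class_mode_eq[OF n p(1)])
  show ?thesis
  proof (cases c)
    case True
    have "?lap (\<lambda>q. cos_mode n j (ucoord n q) * cos_mode n k (vcoord n q)) p =
        mode_eigenvalue n (j, k) * point_weight n p * pillow_mode n i p b"
      unfolding uv(1) laplacian_diamond_product[OF uv(2) n]
        sum_path_nbrs_cos_mode[OF n uv2(1)] sum_path_nbrs_cos_mode[OF n uv2(2)]
      by (simp add: i True mode_eigenvalue_def point_weight_def algebra_simps)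
    then have "(\<Sum>c \<in> ?K. ?lap (\<lambda>q. pillow_mode n i q c) p) =
        (\<Sum>c \<in> ?K. mode_eigenvalue n (j, k) * point_weight n p * pillow_mode n i p b)"
      using i True by simp
    then show ?thesis unfolding lap w m by (simp add: i)
  next
    case False
    let ?s = "\<lambda>q. sin_mode n j (ucoord n q) * sin_mode n k (vcoord n q)"
    have l: "?lap (\<lambda>q. pillow_mode n i q c) p = (if c then 1 else -1) * ?lap ?s p" for c
      using laplacian_scale[of "ends ?G" "edges ?G" "if c then 1 else -1" ?s p] i False by simp
    show ?thesis
    proof (cases "p \<in> ?B")
      case True
      then have "?K = {True, False}" by auto
      then have "(\<Sum>c \<in> ?K. ?lap (\<lambda>q. pillow_mode n i q c) p) = 0" unfolding l by simp
      moreover have "pillow_mode n i p b = 0"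
        using sin_modes_sphere[OF n p(1) True, of j k] i False by (simp del: mult_eq_0_iff)
      ultimately show ?thesis unfolding lap m by simp
    next
      case nB: False
      then have K: "?K = {b}" by auto
      have int: "0 < u" "u < 2*n" "0 < v" "v < 2*n"
        using nB lattice_pt_in_sphere_iff[OF uv2] uv2 unfolding uv(1) by auto
      then have e: "end_weight n (real u) = 1" "end_weight n (real v) = 1"
        by (auto simp: end_weight_of_nat)
      have "?lap ?s p = mode_eigenvalue n (j, k) * ?s p"
        unfolding uv(1) laplacian_diamond_product[OF uv(2) n]
          sum_path_nbrs_sin_mode[OF n int(1,2)] sum_path_nbrs_sin_mode[OF n int(3,4)] e
        by (simp add: mode_eigenvalue_def algebra_simps)
      moreover have "point_weight n p = 1" unfolding uv(1) point_weight_def by (simp add: e)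
      ultimately show ?thesis unfolding lap w m K by (simp only: l) (simp add: l i False)
    qed
  qed
qed

section \<open>Vertex count, total weight and product of the weights\<close>

lemma sphere_complement:
  assumes "n \<ge> 1"
  shows "verts (diamond n ev) - l1_sphere n = lattice_pt n ` parity_pairs ev {1..2*n - 1}"
proof -
  have "a \<in> parity_pairs ev {0..2*n} \<and> lattice_pt n a \<notin> l1_sphere n \<longleftrightarrow>
      a \<in> parity_pairs ev {1..2*n - 1}" for a
  proof (cases a)
    case (Pair u v)
    show ?thesis
    proof (cases "u \<le> 2*n \<and> v \<le> 2*n")
      case True
      then have "lattice_pt n a \<in> l1_sphere n \<longleftrightarrow> u = 0 \<or> u = 2*n \<or> v = 0 \<or> v = 2*n"
        unfolding Pair by (intro lattice_pt_in_sphere_iff) auto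
      moreover have "u \<in> {1..2*n - 1} \<longleftrightarrow> u \<noteq> 0 \<and> u \<noteq> 2*n" "v \<in> {1..2*n - 1} \<longleftrightarrow> v \<noteq> 0 \<and> v \<noteq> 2*n"
        using True by auto
      moreover have "u \<in> {0..2*n}" "v \<in> {0..2*n}" using True by auto
      ultimately show ?thesis unfolding Pair mem_parity_pairs by blast
    qed (auto simp: Pair mem_parity_pairs)
  qed
  then show ?thesis unfolding verts_diamond by blast
qed

lemma card_pillow_modes:
  assumes n: "n \<ge> 1"
  shows "card (pillow_modes n ev) = card (verts (pillowcase (diamond n ev) (l1_sphere n)))"
proof -
  have "card (pillow_modes n ev) = card (half_square n ev {0..2*n}) + card (half_square n ev {1..2*n - 1})"
    unfolding pillow_modes_def
    by (subst card_Un_disjoint) (auto simp: card_cartesian_product finite_half_square)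
  moreover have "card (verts (pillowcase (diamond n ev) (l1_sphere n))) =
      card (parity_pairs ev {0..2*n}) + card (parity_pairs ev {1..2*n - 1})"
  proof -
    have "card (verts (pillowcase (diamond n ev) (l1_sphere n))) =
        card (verts (diamond n ev)) + card (verts (diamond n ev) - l1_sphere n)"
      by (rule card_verts_pillowcase[OF finite_multigraphD(1)[OF finite_multigraph_diamond]])
    then show ?thesis
      unfolding sphere_complement[OF n] unfolding verts_diamond
      by (simp only: card_image[OF inj_on_subset[OF inj_lattice_pt subset_UNIV]])
  qed
  moreover have "card (half_square n ev {a..2*n - a}) = card (parity_pairs ev {a..2*n - a})" if "a \<le> n" for a
    using card_half_square[OF that, of ev] card_parity_pairs[OF that, of ev] by simp
  from this[of 0] this[of 1] have "card (half_square n ev {0..2*n}) = card (parity_pairs ev {0..2*n})"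
    "card (half_square n ev {1..2*n - 1}) = card (parity_pairs ev {1..2*n - 1})" using n by simp_all
  ultimately show ?thesis by simp
qed

text \<open>Each coordinate has total weight \<open>2n\<close> and alternating sum 0, so either
  parity class carries half of (2n)^2 on each of the two sheets.\<close>

lemma sum_pillow_weight:
  assumes n: "n \<ge> 1"
  shows "(\<Sum>C \<in> verts (pillowcase (diamond n ev) (l1_sphere n)). pillow_weight n C) = 4 * (real n)\<^sup>2"
proof -
  have s: "(\<Sum>u\<le>2*n. end_weight n (real u)) = 2 * real n"
    using sum_end_weight[OF n, of "\<lambda>_. 1"] by simp
  have a: "(\<Sum>u\<le>2*n. (-1)^u * end_weight n (real u)) = 0"
    using sum_end_weight[OF n, of "\<lambda>u. (-1)^u"] by (simp add: mult.commute)
  have "(\<Sum>C \<in> verts (pillowcase (diamond n ev) (l1_sphere n)). pillow_weight n C) =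
      2 * (\<Sum>(u, v) \<in> parity_pairs ev {0..2*n}. end_weight n (real u) * end_weight n (real v))"
    unfolding pillow_weight_def sum_diamond_pillow[where f = "\<lambda>p b. point_weight n p"] sum_distrib_left
    by (intro sum.cong refl) (simp add: point_weight_def split_def)
  then show ?thesis
    unfolding sum_parity_pairs[OF finite_atLeastAtMost] unfolding atLeast0AtMost s a
    by (simp add: power2_eq_square)
qed

text \<open>On the seam the two sheets double the weight: 1/2 becomes 1 on the sides and 1/4 becomes
  1/2 at the corners. All four corners have even \<open>u + v\<close>.\<close>

lemma prod_pillow_weight:
  assumes n: "n \<ge> 1"
  shows "(\<Prod>C \<in> verts (pillowcase (diamond n ev) (l1_sphere n)). pillow_weight n C) =
    (if ev then 1/16 else 1)"
proof -
  let ?G = "diamond n ev" and ?B = "l1_sphere n" and ?P = "parity_pairs ev {0..2*n}"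
  let ?E = "{0, 2*n}"
  have w: "pillow_weight n (pillow_class ?B (p, b)) =
      (if p \<in> ?B then 2 * point_weight n p else point_weight n p)" for p b
  proof -
    have "pillow_class ?B (p, b) = (if p \<in> ?B then {(p, True), (p, False)} else {(p, b)})"
      unfolding pillow_class_def by auto
    then show ?thesis unfolding pillow_weight_def by simp
  qed
  have if_prod: "(\<Prod>a \<in> A. if a \<in> D then c else 1) = c ^ card (A \<inter> D)"
    if "finite A" for A D and c :: real
    using that by (simp add: prod.If_cases)
  have wl: "pillow_weight n (pillow_class ?B (lattice_pt n a, b)) =
      (if a \<in> ?E \<times> ?E then 1/2 else 1)" if aP: "a \<in> ?P" for a b
  proof -
    obtain u v where a: "a = (u, v)" "u \<le> 2*n" "v \<le> 2*n"
      using aP unfolding parity_pairs_def by auto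
    show ?thesis
      unfolding w a(1) lattice_pt_in_sphere_iff[OF a(2,3)] point_weight_def
        ucoord_lattice_pt vcoord_lattice_pt end_weight_of_nat by auto
  qed
  have "(\<Prod>p \<in> verts ?G - ?B. pillow_weight n (pillow_class ?B (p, True))) = 1"
    unfolding sphere_complement[OF n]
  proof (intro prod.neutral ballI)
    fix p assume "p \<in> lattice_pt n ` parity_pairs ev {1..2*n - 1}"
    then obtain a where a: "p = lattice_pt n a" "a \<in> parity_pairs ev {1..2*n - 1}" by blast
    then have "a \<in> ?P" "a \<notin> ?E \<times> ?E" by (auto simp: parity_pairs_def)
    then show "pillow_weight n (pillow_class ?B (p, True)) = 1" unfolding a(1) by (simp only: wl if_False)
  qed
  moreover have "(\<Prod>p \<in> verts ?G. pillow_weight n (pillow_class ?B (p, False))) = (if ev then 1/16 else 1)"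
  proof -
    have "(\<Prod>p \<in> verts ?G. pillow_weight n (pillow_class ?B (p, False))) =
        (\<Prod>a \<in> ?P. pillow_weight n (pillow_class ?B (lattice_pt n a, False)))"
      unfolding verts_diamond using inj_lattice_pt by (subst prod.reindex) (auto intro: inj_on_subset)
    also have "\<dots> = (\<Prod>a \<in> ?P. if a \<in> ?E \<times> ?E then 1/2 else 1)"
      by (intro prod.cong refl wl)
    also have "\<dots> = (1/2) ^ card (?P \<inter> ?E \<times> ?E)"
      by (rule if_prod[OF finite_parity_pairs[OF finite_atLeastAtMost]])
    also have "?P \<inter> ?E \<times> ?E = (if ev then ?E \<times> ?E else {})"
      by (auto simp: parity_pairs_def)
    also have "(1/2 :: real) ^ card (if ev then ?E \<times> ?E else {}) = (if ev then 1/16 else 1)"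
      using n by (simp add: card_cartesian_product)
    finally show ?thesis .
  qed
  ultimately show ?thesis
    unfolding prod_pillow_classes[OF finite_multigraphD(1)[OF finite_multigraph_diamond]] by simp
qed

lemma pillow_spanning_trees:
  assumes n: "n \<ge> 1"
  shows "4 * (real n)\<^sup>2 * real (num_spanning_trees (pillowcase (diamond n ev) (l1_sphere n))) =
    (if ev then 1/16 else 1) * (\<Prod>i \<in> pillow_modes n ev - {(True, 0, 0)}. mode_eigenvalue n (snd i))"
proof -
  let ?P = "pillowcase (diamond n ev) (l1_sphere n)" and ?I = "pillow_modes n ev"
  have zero: "(True, 0, 0) \<in> ?I" using n by (auto simp: pillow_modes_def half_square_def)
  have fin: "finite ?I" unfolding pillow_modes_def by (auto intro: finite_half_square)
  have "(\<Sum>C \<in> verts ?P. pillow_weight n C) * real (num_spanning_trees ?P) =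
      (\<Prod>C \<in> verts ?P. pillow_weight n C) * (\<Prod>i \<in> ?I - {(True, 0, 0)}. mode_eigenvalue n (snd i))"
  proof (rule spanning_trees_eigenbasis[where F = "class_mode n"])
    show "finite_multigraph ?P" by (rule finite_multigraph_pillowcase[OF finite_multigraph_diamond])
    show "finite ?I" "card ?I = card (verts ?P)" "(True, 0, 0) \<in> ?I"
      by (rule fin card_pillow_modes[OF n] zero)+
    show "(\<Sum>C \<in> verts ?P. pillow_weight n C * class_mode n i C * class_mode n k C) = 0"
      if "i \<in> ?I" "k \<in> ?I" "i \<noteq> k" for i k
      by (rule pillow_modes_orthogonal(1)[OF n that])
    show "(\<Sum>C \<in> verts ?P. pillow_weight n C * class_mode n i C * class_mode n i C) \<noteq> 0"
      if "i \<in> ?I" for i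
      by (rule pillow_modes_orthogonal(2)[OF n that that refl])
    show "laplacian (ends ?P) (edges ?P) (class_mode n i) C =
        mode_eigenvalue n (snd i) * pillow_weight n C * class_mode n i C"
      if "i \<in> ?I" "C \<in> verts ?P" for i C
      by (rule pillow_mode_eigen[OF n that(2)])
    show "class_mode n (True, 0, 0) C = 1" if C: "C \<in> verts ?P" for C
    proof -
      obtain p b where p: "p \<in> verts (diamond n ev)" "C = pillow_class (l1_sphere n) (p, b)"
        using C unfolding verts_pillowcase by auto
      show ?thesis unfolding p(2) class_mode_eq[OF n p(1)] by (simp add: cos_mode_def)
    qed
  qed
  then show ?thesis unfolding sum_pillow_weight[OF n] prod_pillow_weight[OF n] .
qed

section \<open>The product of the eigenvalues\<close>

lemma mode_eigenvalue_nonneg: "mode_eigenvalue n p \<ge> 0"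
proof -
  have "x * y \<le> 1" if "\<bar>x\<bar> \<le> 1" "\<bar>y\<bar> \<le> 1" for x y :: real
    using mult_mono[OF that] abs_le_D1[of "x * y" 1] by (simp add: abs_mult)
  from this[OF abs_cos_le_one abs_cos_le_one] show ?thesis
    by (simp add: mode_eigenvalue_def split_def mult.assoc)
qed

lemma cos_frequency_reflect:
  assumes "n \<ge> 1" "j \<le> 2*n"
  shows "cos (real (2*n - j) * pi / (2 * real n)) = - cos (real j * pi / (2 * real n))"
proof -
  have "real (2*n - j) * pi / (2 * real n) = pi - real j * pi / (2 * real n)"
    using assms by (simp add: of_nat_diff field_simps)
  then show ?thesis by simp
qed

text \<open>\<open>X\<close> and \<open>Y\<close> are the contributions of the cosine and sine modes
  for the odd class; the even class adds a factor 4 to each. Completing both half squares gives 16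
  (X Y)^2 = 64 P^4 Q^2.\<close>

lemma prod_pillow_modes:
  assumes n: "n \<ge> 1"
  shows "(\<Prod>i \<in> pillow_modes n ev - {(True, 0, 0)}. mode_eigenvalue n (snd i)) =
    (if ev then 16 else 1) * (2 * (\<Prod>j = 1..2*n - 1. (4 - 4 * cos (real j * pi / (2 * real n))))\<^sup>2 *
      (\<Prod>p \<in> {1..2*n - 1} \<times> {1..2*n - 1}. mode_eigenvalue n p))"
proof -
  let ?T = "{1..2*n - 1}" and ?S = "{0..2*n}" and ?l = "mode_eigenvalue n"
  define P where "P = (\<Prod>j \<in> ?T. (4 - 4 * cos (real j * pi / (2 * real n))))"
  define Q where "Q = (\<Prod>p \<in> ?T \<times> ?T. ?l p)"
  \<comment> \<open>The eigenvalue vanishes at \<open>(0, 0)\<close> and at its reflection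
    \<open>(2n, 2n)\<close>. Both are set to 1 to keep the symmetry; only the first lies in the half
    square, where it is the omitted constant mode.\<close>
  define f where "f p = (if p = (0, 0) \<or> p = (2*n, 2*n) then 1 else ?l p)" for p
  define X where "X = (\<Prod>p \<in> half_square n False ?S. f p)"
  define Y where "Y = (\<Prod>p \<in> half_square n False ?T. ?l p)"
  have reflect: "?l (2*n - j, 2*n - k) = ?l (j, k)" if "j \<le> 2*n" "k \<le> 2*n" for j k
    unfolding mode_eigenvalue_def prod.case cos_frequency_reflect[OF n that(1)]
      cos_frequency_reflect[OF n that(2)] by simp
  have f_refl: "f (2*n - j, 2*n - k) = f (j, k)" if "j \<in> {0..2*n - 0}" "k \<in> {0..2*n - 0}" for j k
  proof -
    have le: "j \<le> 2*n" "k \<le> 2*n" using that by auto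
    then have "2*n - j = 0 \<longleftrightarrow> j = 2*n" "2*n - k = 0 \<longleftrightarrow> k = 2*n"
      "2*n - j = 2*n \<longleftrightarrow> j = 0" "2*n - k = 2*n \<longleftrightarrow> k = 0"
      using n by linarith+
    then show ?thesis unfolding f_def prod.inject reflect[OF le] by auto
  qed
  have l_refl: "?l (2*n - j, 2*n - k) = ?l (j, k)" if "j \<in> {1..2*n - 1}" "k \<in> {1..2*n - 1}" for j k
    using that by (intro reflect) auto
  have nn: "?l (n, n) = 4" "f (n, n) = 4"
    using n by (simp_all add: f_def mode_eigenvalue_def)
  have nonneg: "f p \<ge> 0" for p using mode_eigenvalue_nonneg by (simp add: f_def)
  have X: "(\<Prod>p \<in> half_square n True ?S. f p) = 4 * X" "(\<Prod>p \<in> ?S \<times> ?S. f p) = 4 * X\<^sup>2"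
    using prod_half_square[of 0 n f, OF le0 f_refl] unfolding X_def nn by simp_all
  have Y: "(\<Prod>p \<in> half_square n True ?T. ?l p) = 4 * Y" "Q = 4 * Y\<^sup>2"
    using prod_half_square[of 1 n ?l, OF n l_refl] unfolding Y_def Q_def nn by simp_all
  \<comment> \<open>Two opposite corners give 1, the other two give 8, each of the four sides gives
    \<open>P\<close>, and the inner square gives \<open>Q\<close>.\<close>
  have full: "(\<Prod>p \<in> ?S \<times> ?S. f p) = 64 * P^4 * Q"
  proof -
    have S: "?S = insert 0 (insert (2*n) ?T)" "0 \<notin> insert (2*n) ?T" "2*n \<notin> ?T" using n by auto
    have ins: "(\<Prod>j \<in> ?S. g j) = g 0 * (g (2*n) * (\<Prod>j \<in> ?T. g j))" for g :: "nat \<Rightarrow> real"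
      unfolding S(1) using S(2,3) by simp
    \<comment> \<open>Reversing \<open>j\<close> to \<open>2n - j\<close> negates the
      cosine.\<close>
    have Prev: "(\<Prod>j \<in> ?T. 4 + 4 * cos (real j * pi / (2 * real n))) = P"
    proof -
      have "P = (\<Prod>j \<in> ?T. 4 - 4 * cos (real (2*n - 1 + 1 - j) * pi / (2 * real n)))"
        unfolding P_def by (rule prod.atLeastAtMost_rev)
      also have "\<dots> = (\<Prod>j \<in> ?T. 4 + 4 * cos (real j * pi / (2 * real n)))"
        using n cos_frequency_reflect[OF n] by (intro prod.cong refl) auto
      finally show ?thesis by simp
    qed
    have c2: "cos (real (2*n) * pi / (2 * real n)) = -1" using n by simp
    have row0: "(\<Prod>k \<in> ?S. f (0, k)) = 8 * P"
      unfolding ins using n c2 by (simp add: f_def mode_eigenvalue_def P_def)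
    have rowe: "(\<Prod>k \<in> ?S. f (2*n, k)) = 8 * P"
    proof -
      have "(\<Prod>k \<in> ?T. f (2*n, k)) = (\<Prod>k \<in> ?T. 4 + 4 * cos (real k * pi / (2 * real n)))"
      proof (intro prod.cong refl)
        fix k assume "k \<in> ?T"
        then have "k \<noteq> 2*n" by auto
        then show "f (2*n, k) = 4 + 4 * cos (real k * pi / (2 * real n))"
          using n c2 by (simp add: f_def mode_eigenvalue_def)
      qed
      moreover have "f (2*n, 0) = 8" "f (2*n, 2*n) = 1"
        using n c2 by (simp_all add: f_def mode_eigenvalue_def)
      ultimately show ?thesis unfolding ins Prev by simp
    qed
    have row: "(\<Prod>k \<in> ?S. f (j, k)) = (4 - 4 * cos (real j * pi / (2 * real n))) *
        (4 + 4 * cos (real j * pi / (2 * real n))) * (\<Prod>k \<in> ?T. ?l (j, k))" if "j \<in> ?T" for j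
      unfolding ins using that n c2 by (auto simp: f_def mode_eigenvalue_def)
    have "(\<Prod>p \<in> ?S \<times> ?S. f p) = (\<Prod>j \<in> ?S. \<Prod>k \<in> ?S. f (j, k))"
      by (simp add: prod.cartesian_product)
    also have "\<dots> = 8 * P * (8 * P * (\<Prod>j \<in> ?T. \<Prod>k \<in> ?S. f (j, k)))"
      unfolding ins[of "\<lambda>j. \<Prod>k \<in> ?S. f (j, k)"] row0 rowe ..
    also have "(\<Prod>j \<in> ?T. \<Prod>k \<in> ?S. f (j, k)) = P * P * Q"
      using row Prev by (simp add: prod.distrib P_def Q_def prod.cartesian_product)
    finally show ?thesis by (simp add: power4_eq_xxxx)
  qed
  have "(X * Y)\<^sup>2 = (2 * P\<^sup>2 * Q)\<^sup>2"
  proof -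
    have "16 * (X * Y)\<^sup>2 = (4 * X\<^sup>2) * (4 * Y\<^sup>2)" by (simp add: power_mult_distrib)
    also have "\<dots> = 64 * P^4 * Q * Q" unfolding X(2)[symmetric] full Y(2)[symmetric] ..
    also have "\<dots> = 16 * (2 * P\<^sup>2 * Q)\<^sup>2"
      unfolding power4_eq_xxxx power2_eq_square by (simp only: mult_ac)
    finally show ?thesis by simp
  qed
  moreover have "0 \<le> X * Y" unfolding X_def Y_def
    by (intro mult_nonneg_nonneg prod_nonneg nonneg mode_eigenvalue_nonneg)
  moreover have "0 \<le> 2 * P\<^sup>2 * Q" unfolding Q_def
    by (intro mult_nonneg_nonneg prod_nonneg mode_eigenvalue_nonneg) auto
  \<comment> \<open>Nonnegativity of the eigenvalues selects the root.\<close>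
  ultimately have XY: "X * Y = 2 * P\<^sup>2 * Q" by (simp add: power2_eq_iff_nonneg)
  have "(\<Prod>i \<in> pillow_modes n ev - {(True, 0, 0)}. ?l (snd i)) =
      (\<Prod>p \<in> half_square n ev ?S. f p) * (\<Prod>p \<in> half_square n ev ?T. ?l p)"
  proof -
    let ?H = "half_square n ev ?S" and ?H' = "half_square n ev ?T"
    have r: "(\<Prod>i \<in> {c} \<times> A. ?l (snd i)) = (\<Prod>p \<in> A. ?l p)" for c :: bool and A
      by (rule prod.reindex_cong[of "\<lambda>p. (c, p)"]) (auto intro: inj_onI)
    have "pillow_modes n ev - {(True, 0, 0)} = {True} \<times> (?H - {(0, 0)}) \<union> {False} \<times> ?H'"
      unfolding pillow_modes_def by auto
    then have "(\<Prod>i \<in> pillow_modes n ev - {(True, 0, 0)}. ?l (snd i)) =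
        (\<Prod>i \<in> {True} \<times> (?H - {(0, 0)}). ?l (snd i)) * (\<Prod>i \<in> {False} \<times> ?H'. ?l (snd i))"
      by (simp only:) (intro prod.union_disjoint, auto simp: finite_half_square)
    moreover have "(\<Prod>p \<in> ?H. f p) = (\<Prod>p \<in> ?H - {(0, 0)}. ?l p)"
    proof -
      have "(0, 0) \<in> ?H" "(2*n, 2*n) \<notin> ?H" using n by (auto simp: half_square_def)
      then have "(\<Prod>p \<in> ?H. f p) = f (0, 0) * (\<Prod>p \<in> ?H - {(0, 0)}. f p)"
        by (intro prod.remove finite_half_square) auto
      also have "(\<Prod>p \<in> ?H - {(0, 0)}. f p) = (\<Prod>p \<in> ?H - {(0, 0)}. ?l p)"
        using \<open>(2*n, 2*n) \<notin> ?H\<close> by (intro prod.cong refl) (auto simp: f_def)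
      finally show ?thesis by (simp add: f_def)
    qed
    ultimately show ?thesis unfolding r by simp
  qed
  also have "\<dots> = (if ev then 16 else 1) * (X * Y)"
    using X(1) Y(1) by (cases ev) (simp_all add: X_def Y_def)
  finally show ?thesis unfolding XY P_def Q_def .
qed

theorem corollary6p2:
  fixes n :: nat
  assumes "n \<ge> 1"
  shows "num_spanning_trees (aztec_pillowcase n) = num_spanning_trees (odd_aztec_pillowcase n) \<and>
    real (num_spanning_trees (odd_aztec_pillowcase n)) =
      1 / (2 * (real n)\<^sup>2) *
      (\<Prod>j = 1..2*n - 1. (4 - 4 * cos (real j * pi / (2 * real n)))\<^sup>2) *
      (\<Prod>(j, k) \<in> {1..2*n - 1} \<times> {1..2*n - 1}.
         4 - 4 * cos (real j * pi / (2 * real n)) * cos (real k * pi / (2 * real n)))"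
proof -
  define R where "R = (\<Prod>j = 1..2*n - 1. (4 - 4 * cos (real j * pi / (2 * real n)))\<^sup>2) *
      (\<Prod>p \<in> {1..2*n - 1} \<times> {1..2*n - 1}. mode_eigenvalue n p)"
  have t: "real (num_spanning_trees (pillowcase (diamond n ev) (l1_sphere n))) =
      1 / (2 * (real n)\<^sup>2) * R" for ev
  proof -
    have "4 * (real n)\<^sup>2 * real (num_spanning_trees (pillowcase (diamond n ev) (l1_sphere n))) = 2 * R"
      using pillow_spanning_trees[OF assms, of ev] unfolding prod_pillow_modes[OF assms] R_def
      by (cases ev) (simp_all add: prod_power_distrib)
    then show ?thesis using assms by (simp add: field_simps)
  qed
  have odd: "odd_aztec_pillowcase n = pillowcase (diamond n True) (l1_sphere n)"
    unfolding odd_aztec_pillowcase_def odd_aztec_diamond_eq ..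
  have "aztec_pillowcase n = pillowcase (diamond n False) (l1_sphere n)"
    unfolding aztec_pillowcase_def aztec_diamond_eq ..
  then have "real (num_spanning_trees (aztec_pillowcase n)) =
      real (num_spanning_trees (odd_aztec_pillowcase n))"
    unfolding odd by (simp only: t)
  moreover have "real (num_spanning_trees (odd_aztec_pillowcase n)) = 1 / (2 * (real n)\<^sup>2) * R"
    unfolding odd by (rule t)
  ultimately show ?thesis unfolding R_def mode_eigenvalue_def by (simp add: mult.assoc)
qed

end
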